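(* Let $K$ be an arbitrary field and let $R$ be a (not necessarily commutative) unitary associative algebra over $K$. If the free product $R\ast K[z]$ is isomorphic as a $K$-algebra to the free associative algebra $K\langle x,y\rangle$, then $R$ is isomorphic as a $K$-algebra to the polynomial algebra $K[x]$ in one variable.
   Context: Algebras are associative with unit, not necessarily commutative, and $K$-isomorphic means isomorphic as unital $K$-algebras. $K\langle x,y\rangle$ denotes the free unital associative $K$-algebra of rank two on generators $x,y$ (noncommuting polynomials). $R\ast K[z]$ denotes the free product (coproduct in the category of unital associative $K$-algebras) of $R$ and the one-variable polynomial algebra $K[z]$. Explicitly: if $\{r_i\mid i\in I\}$ is a $K$-basis of $R$ with $r_ir_j=\sum_{k\in I}\alpha_{ij}^k r_k$, $\alpha_{ij}^k\in K$, then $R\ast K[z]$ has as a $K$-basis all products $r_{i_0}zr_{i_1}z\cdots r_{i_{a-1}}zr_{i_a}$ ($a\ge 0$, $i_0,\dots,i_a\in I$), with multiplication $$(r_{i_0}z\cdots r_{i_{a-1}}zr_{i_a})(r_{j_0}zr_{j_1}z\cdots zr_{j_b})=\sum_{k\in I}\alpha_{i_aj_0}^k\, r_{i_0}z\cdots r_{i_{a-1}}zr_kzr_{j_1}z\cdots zr_{j_b}.$$ *)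

theory Defs
  imports "HOL-Algebra.UnivPoly" "HOL-Algebra.QuotRing"
begin

section \<open>Associative unital algebras\<close>

text \<open>The locale \<^locale>\<open>algebra\<close> of HOL-Algebra requires multiplication to be
  commutative; here it need not be. The zero algebra is allowed.\<close>

locale assoc_algebra = V?: module K A + A?: ring A for K (structure) and A (structure) +
  assumes smult_mult_left:
      "\<lbrakk>a \<in> carrier K; x \<in> carrier A; y \<in> carrier A\<rbrakk>
        \<Longrightarrow> (a \<odot>\<^bsub>A\<^esub> x) \<otimes>\<^bsub>A\<^esub> y = a \<odot>\<^bsub>A\<^esub> (x \<otimes>\<^bsub>A\<^esub> y)"
    and smult_mult_right:
      "\<lbrakk>a \<in> carrier K; x \<in> carrier A; y \<in> carrier A\<rbrakk>
        \<Longrightarrow> x \<otimes>\<^bsub>A\<^esub> (a \<odot>\<^bsub>A\<^esub> y) = a \<odot>\<^bsub>A\<^esub> (x \<otimes>\<^bsub>A\<^esub> y)"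

definition alg_hom ::
    "('k, 'l) ring_scheme \<Rightarrow> ('k, 'a, 'm) module_scheme \<Rightarrow> ('k, 'b, 'n) module_scheme \<Rightarrow> ('a \<Rightarrow> 'b) set"
  where "alg_hom K A B = {h \<in> ring_hom A B.
    \<forall>a\<in>carrier K. \<forall>x\<in>carrier A. h (a \<odot>\<^bsub>A\<^esub> x) = a \<odot>\<^bsub>B\<^esub> h x}"

definition alg_isomorphic ::
    "('k, 'l) ring_scheme \<Rightarrow> ('k, 'a, 'm) module_scheme \<Rightarrow> ('k, 'b, 'n) module_scheme \<Rightarrow> bool"
  where "alg_isomorphic K A B \<longleftrightarrow> (\<exists>h\<in>alg_hom K A B. bij_betw h (carrier A) (carrier B))"


section \<open>Free associative algebras\<close>

text \<open>Elements of the free algebra on \<open>X\<close> are the finitely supported \<open>K\<close>-valued functions on the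
  words over \<open>X\<close>; the monomial \<open>x\<^sub>1 \<dots> x\<^sub>n\<close> is the word \<open>[x\<^sub>1, \<dots>, x\<^sub>n]\<close>, and the coefficient of a
  product at \<open>w\<close> sums over all factorizations \<open>w = u @ v\<close>.\<close>

definition free_algebra :: "('k, 'l) ring_scheme \<Rightarrow> 'x set \<Rightarrow> ('k, 'x list \<Rightarrow> 'k) module"
  where "free_algebra K X = \<lparr>
    carrier = {f. (\<forall>w. f w \<in> carrier K) \<and> finite {w. f w \<noteq> \<zero>\<^bsub>K\<^esub>} \<and>
                  (\<forall>w. f w \<noteq> \<zero>\<^bsub>K\<^esub> \<longrightarrow> set w \<subseteq> X)},
    mult = (\<lambda>f g w. \<Oplus>\<^bsub>K\<^esub>i\<in>{..length w}. f (take i w) \<otimes>\<^bsub>K\<^esub> g (drop i w)),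
    one = (\<lambda>w. if w = [] then \<one>\<^bsub>K\<^esub> else \<zero>\<^bsub>K\<^esub>),
    zero = (\<lambda>w. \<zero>\<^bsub>K\<^esub>),
    add = (\<lambda>f g w. f w \<oplus>\<^bsub>K\<^esub> g w),
    smult = (\<lambda>a f w. a \<otimes>\<^bsub>K\<^esub> f w)\<rparr>"

definition word :: "('k, 'l) ring_scheme \<Rightarrow> 'x list \<Rightarrow> 'x list \<Rightarrow> 'k"
  where "word K u = (\<lambda>w. if w = u then \<one>\<^bsub>K\<^esub> else \<zero>\<^bsub>K\<^esub>)"


section \<open>Quotient algebras and free products\<close>

definition quot_algebra :: "('k, 'a, 'm) module_scheme \<Rightarrow> 'a set \<Rightarrow> ('k, 'a set) module"
  where "quot_algebra A I = \<lparr>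
    carrier = carrier (A Quot I),
    mult = mult (A Quot I),
    one = one (A Quot I),
    zero = zero (A Quot I),
    add = add (A Quot I),
    smult = (\<lambda>a D. \<Union>x\<in>D. I +>\<^bsub>A\<^esub> (a \<odot>\<^bsub>A\<^esub> x))\<rparr>"

text \<open>The free product of \<open>A\<close> and \<open>B\<close> is the free algebra on the disjoint union of their carriers,
  modulo the relations making both inclusions of generators into algebra homomorphisms. That this
  is the coproduct in the category of unital associative algebras is shown at the end of this
  theory.\<close>

definition incl_rels ::
    "('k, 'l) ring_scheme \<Rightarrow> ('k, 'x list \<Rightarrow> 'k) module \<Rightarrow> ('k, 'a, 'm) module_scheme
      \<Rightarrow> ('a \<Rightarrow> 'x) \<Rightarrow> ('x list \<Rightarrow> 'k) set"
  where "incl_rels K F A j =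
      {word K [j (x \<oplus>\<^bsub>A\<^esub> y)] \<ominus>\<^bsub>F\<^esub> (word K [j x] \<oplus>\<^bsub>F\<^esub> word K [j y]) | x y.
          x \<in> carrier A \<and> y \<in> carrier A}
    \<union> {word K [j (x \<otimes>\<^bsub>A\<^esub> y)] \<ominus>\<^bsub>F\<^esub> (word K [j x] \<otimes>\<^bsub>F\<^esub> word K [j y]) | x y.
          x \<in> carrier A \<and> y \<in> carrier A}
    \<union> {word K [j (a \<odot>\<^bsub>A\<^esub> x)] \<ominus>\<^bsub>F\<^esub> (a \<odot>\<^bsub>F\<^esub> word K [j x]) | a x.
          a \<in> carrier K \<and> x \<in> carrier A}
    \<union> {word K [j \<one>\<^bsub>A\<^esub>] \<ominus>\<^bsub>F\<^esub> \<one>\<^bsub>F\<^esub>}"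

definition free_product_ideal ::
    "('k, 'l) ring_scheme \<Rightarrow> ('k, 'a, 'm) module_scheme \<Rightarrow> ('k, 'b, 'n) module_scheme
      \<Rightarrow> (('a + 'b) list \<Rightarrow> 'k) set"
  where "free_product_ideal K A B =
    (let F = free_algebra K (carrier A <+> carrier B)
     in Idl\<^bsub>F\<^esub> (incl_rels K F A Inl \<union> incl_rels K F B Inr))"

definition free_product ::
    "('k, 'l) ring_scheme \<Rightarrow> ('k, 'a, 'm) module_scheme \<Rightarrow> ('k, 'b, 'n) module_scheme
      \<Rightarrow> ('k, (('a + 'b) list \<Rightarrow> 'k) set) module"
  where "free_product K A B =
    quot_algebra (free_algebra K (carrier A <+> carrier B)) (free_product_ideal K A B)"

definition free_product_inl ::
    "('k, 'l) ring_scheme \<Rightarrow> ('k, 'a, 'm) module_scheme \<Rightarrow> ('k, 'b, 'n) module_scheme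
      \<Rightarrow> 'a \<Rightarrow> (('a + 'b) list \<Rightarrow> 'k) set"
  where "free_product_inl K A B x =
    free_product_ideal K A B +>\<^bsub>free_algebra K (carrier A <+> carrier B)\<^esub> word K [Inl x]"

definition free_product_inr ::
    "('k, 'l) ring_scheme \<Rightarrow> ('k, 'a, 'm) module_scheme \<Rightarrow> ('k, 'b, 'n) module_scheme
      \<Rightarrow> 'b \<Rightarrow> (('a + 'b) list \<Rightarrow> 'k) set"
  where "free_product_inr K A B y =
    free_product_ideal K A B +>\<^bsub>free_algebra K (carrier A <+> carrier B)\<^esub> word K [Inr y]"


section \<open>The free algebra is an algebra\<close>

lemma (in abelian_monoid) finsum_diagonal:
  fixes F :: "nat \<Rightarrow> nat \<Rightarrow> 'a"
  assumes F: "\<And>i j. F i j \<in> carrier G"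
  shows "(\<Oplus>j\<in>{..n}. \<Oplus>i\<in>{..j}. F i (j - i)) = (\<Oplus>i\<in>{..n}. \<Oplus>j\<in>{..n - i}. F i j)"
proof (induction n)
  case 0
  then show ?case using F by simp
next
  case (Suc n)
  have "(\<Oplus>i\<in>{..Suc n}. \<Oplus>j\<in>{..Suc n - i}. F i j)
      = F (Suc n) 0 \<oplus> (\<Oplus>i\<in>{..n}. \<Oplus>j\<in>{..Suc n - i}. F i j)"
    using F by (simp add: Pi_def)
  also have "(\<Oplus>i\<in>{..n}. \<Oplus>j\<in>{..Suc n - i}. F i j)
      = (\<Oplus>i\<in>{..n}. F i (Suc n - i) \<oplus> (\<Oplus>j\<in>{..n - i}. F i j))"
    by (rule finsum_cong') (auto simp: F Pi_def Suc_diff_le)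
  also have "\<dots> = (\<Oplus>i\<in>{..n}. F i (Suc n - i)) \<oplus> (\<Oplus>i\<in>{..n}. \<Oplus>j\<in>{..n - i}. F i j)"
    by (rule finsum_addf) (auto simp: F Pi_def)
  also have "F (Suc n) 0 \<oplus> \<dots>
      = (\<Oplus>i\<in>{..Suc n}. F i (Suc n - i)) \<oplus> (\<Oplus>i\<in>{..n}. \<Oplus>j\<in>{..n - i}. F i j)"
    using F by (simp add: Pi_def a_assoc)
  also have "\<dots> = (\<Oplus>j\<in>{..Suc n}. \<Oplus>i\<in>{..j}. F i (j - i))"
    using F Suc.IH by (simp add: Pi_def)
  finally show ?case by simp
qed

locale free_alg = K: cring K for K (structure) and X :: "'x set" and F (structure) +
  defines F_def: "F \<equiv> free_algebra K X"
begin

lemma closed: "f \<in> carrier F \<Longrightarrow> f w \<in> carrier K"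
  by (simp add: F_def free_algebra_def)

lemma support: "f \<in> carrier F \<Longrightarrow> finite {w. f w \<noteq> \<zero>}"
  "f \<in> carrier F \<Longrightarrow> f w \<noteq> \<zero> \<Longrightarrow> set w \<subseteq> X"
  by (simp_all add: F_def free_algebra_def)

lemma carrierI:
  assumes "\<And>w. f w \<in> carrier K" "finite S" "\<And>w. f w \<noteq> \<zero> \<Longrightarrow> w \<in> S \<and> set w \<subseteq> X"
  shows "f \<in> carrier F"
proof -
  have "finite {w. f w \<noteq> \<zero>}" by (rule finite_subset[OF _ assms(2)]) (use assms(3) in auto)
  then show ?thesis using assms by (auto simp: F_def free_algebra_def)
qed

lemma ops:
  "f \<oplus>\<^bsub>F\<^esub> g = (\<lambda>w. f w \<oplus> g w)" "\<zero>\<^bsub>F\<^esub> = (\<lambda>w. \<zero>)" "a \<odot>\<^bsub>F\<^esub> f = (\<lambda>w. a \<otimes> f w)"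
  "f \<otimes>\<^bsub>F\<^esub> g = (\<lambda>w. \<Oplus>i\<in>{..length w}. f (take i w) \<otimes> g (drop i w))"
  "\<one>\<^bsub>F\<^esub> = (\<lambda>w. if w = [] then \<one> else \<zero>)"
  by (simp_all add: F_def free_algebra_def)

lemma one_word: "\<one>\<^bsub>F\<^esub> = word K []"
  by (simp add: ops word_def)

lemma add_closed:
  assumes f: "f \<in> carrier F" and g: "g \<in> carrier F"
  shows "f \<oplus>\<^bsub>F\<^esub> g \<in> carrier F"
proof (rule carrierI[where S = "{w. f w \<noteq> \<zero>} \<union> {w. g w \<noteq> \<zero>}"])
  note [simp] = closed[OF f] closed[OF g]
  show "finite ({w. f w \<noteq> \<zero>} \<union> {w. g w \<noteq> \<zero>})"
    using support(1)[OF f] support(1)[OF g] by simp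
  show "(f \<oplus>\<^bsub>F\<^esub> g) w \<in> carrier K" for w using f g by (simp add: ops)
  fix w assume "(f \<oplus>\<^bsub>F\<^esub> g) w \<noteq> \<zero>"
  then have "f w \<noteq> \<zero> \<or> g w \<noteq> \<zero>" by (auto simp: ops)
  then show "w \<in> {w. f w \<noteq> \<zero>} \<union> {w. g w \<noteq> \<zero>} \<and> set w \<subseteq> X"
    using support(2)[OF f, of w] support(2)[OF g, of w] by blast
qed

lemma smult_closed:
  assumes a: "a \<in> carrier K" and f: "f \<in> carrier F"
  shows "a \<odot>\<^bsub>F\<^esub> f \<in> carrier F"
proof (rule carrierI[where S = "{w. f w \<noteq> \<zero>}"])
  note [simp] = closed[OF f]
  show "finite {w. f w \<noteq> \<zero>}" by (rule support(1)[OF f])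
  show "(a \<odot>\<^bsub>F\<^esub> f) w \<in> carrier K" for w using a f by (simp add: ops)
  fix w assume "(a \<odot>\<^bsub>F\<^esub> f) w \<noteq> \<zero>"
  then have "f w \<noteq> \<zero>" using a by (auto simp: ops)
  then show "w \<in> {w. f w \<noteq> \<zero>} \<and> set w \<subseteq> X" using support(2)[OF f] by blast
qed

lemma word_closed: "set w \<subseteq> X \<Longrightarrow> word K w \<in> carrier F"
  by (rule carrierI[where S = "{w}"]) (auto simp: word_def split: if_splits)

lemma zero_closed: "\<zero>\<^bsub>F\<^esub> \<in> carrier F"
  by (rule carrierI[where S = "{}"]) (auto simp: ops)

lemma mult_closed:
  assumes f: "f \<in> carrier F" and g: "g \<in> carrier F"
  shows "f \<otimes>\<^bsub>F\<^esub> g \<in> carrier F"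
proof (rule carrierI[where S = "(\<lambda>(u, v). u @ v) ` ({w. f w \<noteq> \<zero>} \<times> {w. g w \<noteq> \<zero>})"])
  note [simp] = closed[OF f] closed[OF g]
  show "finite ((\<lambda>(u, v). u @ v) ` ({w. f w \<noteq> \<zero>} \<times> {w. g w \<noteq> \<zero>}))"
    using support(1)[OF f] support(1)[OF g] by simp
  show "(f \<otimes>\<^bsub>F\<^esub> g) w \<in> carrier K" for w
    using f g by (auto simp: ops intro!: K.finsum_closed)
  fix w assume nz: "(f \<otimes>\<^bsub>F\<^esub> g) w \<noteq> \<zero>"
  have "\<exists>i\<in>{..length w}. f (take i w) \<otimes> g (drop i w) \<noteq> \<zero>"
  proof (rule ccontr)
    assume "\<not> ?thesis"
    then have "(f \<otimes>\<^bsub>F\<^esub> g) w = \<zero>"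
      unfolding ops by (intro K.add.finprod_one_eqI) auto
    with nz show False by simp
  qed
  then obtain i where i: "f (take i w) \<otimes> g (drop i w) \<noteq> \<zero>" by blast
  have 1: "f (take i w) \<noteq> \<zero>" using i g by force
  have 2: "g (drop i w) \<noteq> \<zero>" using i f by force
  have "set (take i w @ drop i w) \<subseteq> X"
    using support(2)[OF f 1] support(2)[OF g 2] by (simp only: set_append Un_subset_iff)
  then have "set w \<subseteq> X" by (simp only: append_take_drop_id)
  moreover have "w \<in> (\<lambda>(u, v). u @ v) ` ({w. f w \<noteq> \<zero>} \<times> {w. g w \<noteq> \<zero>})"
    using 1 2 by (intro image_eqI[where x = "(take i w, drop i w)"]) simp_all
  ultimately show "w \<in> (\<lambda>(u, v). u @ v) ` ({w. f w \<noteq> \<zero>} \<times> {w. g w \<noteq> \<zero>}) \<and> set w \<subseteq> X"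
    by (intro conjI)
qed

lemma mult_assoc:
  assumes f: "f \<in> carrier F" and g: "g \<in> carrier F" and h: "h \<in> carrier F"
  shows "(f \<otimes>\<^bsub>F\<^esub> g) \<otimes>\<^bsub>F\<^esub> h = f \<otimes>\<^bsub>F\<^esub> (g \<otimes>\<^bsub>F\<^esub> h)"
proof
  note [simp] = closed[OF f] closed[OF g] closed[OF h]
  fix w :: "'x list"
  define T where "T i k = f (take i w) \<otimes> g (take k (drop i w)) \<otimes> h (drop (i + k) w)" for i k
  have T: "T i k \<in> carrier K" for i k using f g h by (simp add: T_def)
  have "((f \<otimes>\<^bsub>F\<^esub> g) \<otimes>\<^bsub>F\<^esub> h) w = (\<Oplus>j\<in>{..length w}. \<Oplus>i\<in>{..j}. T i (j - i))"
    unfolding ops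
  proof (rule K.finsum_cong')
    fix j assume j: "j \<in> {..length w}"
    have "(\<Oplus>i\<in>{..length (take j w)}. f (take i (take j w)) \<otimes> g (drop i (take j w))) \<otimes> h (drop j w)
        = (\<Oplus>i\<in>{..length (take j w)}. f (take i (take j w)) \<otimes> g (drop i (take j w)) \<otimes> h (drop j w))"
      using f g h by (intro K.finsum_ldistr) auto
    also have "\<dots> = (\<Oplus>i\<in>{..j}. T i (j - i))"
      using j T by (intro K.finsum_cong') (auto simp: T_def min_def drop_take)
    finally show "(\<Oplus>i\<in>{..length (take j w)}. f (take i (take j w)) \<otimes> g (drop i (take j w)))
        \<otimes> h (drop j w) = (\<Oplus>i\<in>{..j}. T i (j - i))" .
  qed (auto simp: T)
  also have "\<dots> = (\<Oplus>i\<in>{..length w}. \<Oplus>k\<in>{..length w - i}. T i k)"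
    by (rule K.finsum_diagonal[OF T])
  also have "\<dots> = (f \<otimes>\<^bsub>F\<^esub> (g \<otimes>\<^bsub>F\<^esub> h)) w"
    unfolding ops
  proof (rule K.finsum_cong'[OF refl])
    show "(\<lambda>i. f (take i w) \<otimes> (\<Oplus>k\<in>{..length (drop i w)}. g (take k (drop i w)) \<otimes> h (drop k (drop i w))))
      \<in> {..length w} \<rightarrow> carrier K"
      using f g h by (auto intro!: K.finsum_closed K.m_closed)
    fix i assume i: "i \<in> {..length w}"
    have "f (take i w) \<otimes> (\<Oplus>k\<in>{..length (drop i w)}. g (take k (drop i w)) \<otimes> h (drop k (drop i w)))
      = (\<Oplus>k\<in>{..length (drop i w)}. f (take i w) \<otimes> (g (take k (drop i w)) \<otimes> h (drop k (drop i w))))"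
      using f g h by (intro K.finsum_rdistr) auto
    also have "\<dots> = (\<Oplus>k\<in>{..length w - i}. T i k)"
      using i f g h by (intro K.finsum_cong') (auto simp: T_def K.m_assoc add.commute)
    finally show "(\<Oplus>k\<in>{..length w - i}. T i k) = f (take i w)
      \<otimes> (\<Oplus>k\<in>{..length (drop i w)}. g (take k (drop i w)) \<otimes> h (drop k (drop i w)))" by simp
  qed
  finally show "((f \<otimes>\<^bsub>F\<^esub> g) \<otimes>\<^bsub>F\<^esub> h) w = (f \<otimes>\<^bsub>F\<^esub> (g \<otimes>\<^bsub>F\<^esub> h)) w" .
qed

lemma word_mult: "word K u \<otimes>\<^bsub>F\<^esub> word K v = word K (u @ v)"
proof
  fix w :: "'x list"
  show "(word K u \<otimes>\<^bsub>F\<^esub> word K v) w = word K (u @ v) w"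
  proof (cases "w = u @ v")
    case True
    have "(word K u \<otimes>\<^bsub>F\<^esub> word K v) w = (\<Oplus>i\<in>{..length w}. if length u = i then \<one> else \<zero>)"
      unfolding ops
    proof (rule K.finsum_cong'[OF refl])
      fix i assume "i \<in> {..length w}"
      then have "take i w = u \<Longrightarrow> length u = i" by force
      then show "word K u (take i w) \<otimes> word K v (drop i w) = (if length u = i then \<one> else \<zero>)"
        by (auto simp: word_def True)
    qed auto
    also have "\<dots> = \<one>"
      by (rule K.finsum_singleton[of _ _ "\<lambda>_. \<one>"]) (auto simp: True)
    finally show ?thesis by (simp add: True word_def)
  next
    case False
    then have "(word K u \<otimes>\<^bsub>F\<^esub> word K v) w = \<zero>"
      unfolding ops by (intro K.add.finprod_one_eqI) (auto simp: word_def)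
    then show ?thesis using False by (simp add: word_def)
  qed
qed

lemma one_mult:
  assumes f: "f \<in> carrier F"
  shows "\<one>\<^bsub>F\<^esub> \<otimes>\<^bsub>F\<^esub> f = f" "f \<otimes>\<^bsub>F\<^esub> \<one>\<^bsub>F\<^esub> = f"
proof -
  note [simp] = closed[OF f]
  show "\<one>\<^bsub>F\<^esub> \<otimes>\<^bsub>F\<^esub> f = f"
  proof
    fix w :: "'x list"
    have "(\<one>\<^bsub>F\<^esub> \<otimes>\<^bsub>F\<^esub> f) w = (\<Oplus>i\<in>{..length w}. if 0 = i then f (drop i w) else \<zero>)"
      unfolding ops using f by (intro K.finsum_cong') auto
    also have "\<dots> = f w"
      using f K.finsum_singleton[of 0 "{..length w}" "\<lambda>i. f (drop i w)"] by simp
    finally show "(\<one>\<^bsub>F\<^esub> \<otimes>\<^bsub>F\<^esub> f) w = f w" .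
  qed
  show "f \<otimes>\<^bsub>F\<^esub> \<one>\<^bsub>F\<^esub> = f"
  proof
    fix w :: "'x list"
    have "(f \<otimes>\<^bsub>F\<^esub> \<one>\<^bsub>F\<^esub>) w = (\<Oplus>i\<in>{..length w}. if length w = i then f (take i w) else \<zero>)"
      unfolding ops using f by (intro K.finsum_cong') auto
    also have "\<dots> = f w"
      using f K.finsum_singleton[of "length w" "{..length w}" "\<lambda>i. f (take i w)"] by simp
    finally show "(f \<otimes>\<^bsub>F\<^esub> \<one>\<^bsub>F\<^esub>) w = f w" .
  qed
qed

lemma distrib:
  assumes f: "f \<in> carrier F" and g: "g \<in> carrier F" and h: "h \<in> carrier F"
  shows "(f \<oplus>\<^bsub>F\<^esub> g) \<otimes>\<^bsub>F\<^esub> h = f \<otimes>\<^bsub>F\<^esub> h \<oplus>\<^bsub>F\<^esub> g \<otimes>\<^bsub>F\<^esub> h"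
    "h \<otimes>\<^bsub>F\<^esub> (f \<oplus>\<^bsub>F\<^esub> g) = h \<otimes>\<^bsub>F\<^esub> f \<oplus>\<^bsub>F\<^esub> h \<otimes>\<^bsub>F\<^esub> g"
proof -
  note [simp] = closed[OF f] closed[OF g] closed[OF h]
  show "(f \<oplus>\<^bsub>F\<^esub> g) \<otimes>\<^bsub>F\<^esub> h = f \<otimes>\<^bsub>F\<^esub> h \<oplus>\<^bsub>F\<^esub> g \<otimes>\<^bsub>F\<^esub> h"
    unfolding ops using f g h
    by (subst K.finsum_addf[symmetric]) (auto simp: K.l_distr)
  show "h \<otimes>\<^bsub>F\<^esub> (f \<oplus>\<^bsub>F\<^esub> g) = h \<otimes>\<^bsub>F\<^esub> f \<oplus>\<^bsub>F\<^esub> h \<otimes>\<^bsub>F\<^esub> g"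
    unfolding ops using f g h
    by (subst K.finsum_addf[symmetric]) (auto simp: K.r_distr)
qed

lemma smult_mult:
  assumes a: "a \<in> carrier K" and f: "f \<in> carrier F" and g: "g \<in> carrier F"
  shows "(a \<odot>\<^bsub>F\<^esub> f) \<otimes>\<^bsub>F\<^esub> g = a \<odot>\<^bsub>F\<^esub> (f \<otimes>\<^bsub>F\<^esub> g)" "f \<otimes>\<^bsub>F\<^esub> (a \<odot>\<^bsub>F\<^esub> g) = a \<odot>\<^bsub>F\<^esub> (f \<otimes>\<^bsub>F\<^esub> g)"
proof -
  note [simp] = closed[OF f] closed[OF g]
  show "(a \<odot>\<^bsub>F\<^esub> f) \<otimes>\<^bsub>F\<^esub> g = a \<odot>\<^bsub>F\<^esub> (f \<otimes>\<^bsub>F\<^esub> g)"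
    unfolding ops using a f g
    by (subst K.finsum_rdistr) (auto simp: K.m_assoc)
  show "f \<otimes>\<^bsub>F\<^esub> (a \<odot>\<^bsub>F\<^esub> g) = a \<odot>\<^bsub>F\<^esub> (f \<otimes>\<^bsub>F\<^esub> g)"
    unfolding ops using a f g
    by (subst K.finsum_rdistr) (auto simp: K.m_lcomm)
qed

lemma assoc_algebra: "assoc_algebra K F"
proof -
  have neg: "\<exists>g\<in>carrier F. g \<oplus>\<^bsub>F\<^esub> f = \<zero>\<^bsub>F\<^esub>" if f: "f \<in> carrier F" for f
  proof
    show "(\<ominus> \<one>) \<odot>\<^bsub>F\<^esub> f \<in> carrier F" using f by (intro smult_closed) auto
    show "(\<ominus> \<one>) \<odot>\<^bsub>F\<^esub> f \<oplus>\<^bsub>F\<^esub> f = \<zero>\<^bsub>F\<^esub>"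
      using closed[OF f] by (auto simp: ops K.l_minus K.l_neg)
  qed
  have ag: "abelian_group F"
  proof (rule abelian_groupI)
    fix f g h assume "f \<in> carrier F" "g \<in> carrier F" "h \<in> carrier F"
    note this[THEN closed, simp]
    show "(f \<oplus>\<^bsub>F\<^esub> g) \<oplus>\<^bsub>F\<^esub> h = f \<oplus>\<^bsub>F\<^esub> (g \<oplus>\<^bsub>F\<^esub> h)"
      by (simp add: ops K.a_assoc)
  next
    fix f g assume "f \<in> carrier F" "g \<in> carrier F"
    note this[THEN closed, simp]
    show "f \<oplus>\<^bsub>F\<^esub> g = g \<oplus>\<^bsub>F\<^esub> f"
      by (simp add: ops K.a_comm)
  next
    fix f assume "f \<in> carrier F"
    note this[THEN closed, simp]
    show "\<zero>\<^bsub>F\<^esub> \<oplus>\<^bsub>F\<^esub> f = f" by (simp add: ops)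
  qed (auto intro: add_closed zero_closed neg)
  have oneF: "\<one>\<^bsub>F\<^esub> \<in> carrier F"
    unfolding one_word by (rule word_closed) simp
  have "Group.monoid F"
    by (rule monoidI) (auto simp: mult_closed oneF mult_assoc one_mult)
  then have ring: "ring F"
    by (intro ringI ag) (auto simp: distrib)
  have "module K F"
  proof (rule moduleI[OF K.is_cring ag])
    fix a b f g assume "a \<in> carrier K" "b \<in> carrier K" "f \<in> carrier F"
    note [simp] = this(1,2) closed[OF this(3)]
    show "(a \<oplus> b) \<odot>\<^bsub>F\<^esub> f = a \<odot>\<^bsub>F\<^esub> f \<oplus>\<^bsub>F\<^esub> b \<odot>\<^bsub>F\<^esub> f" by (simp add: ops K.l_distr)
    show "(a \<otimes> b) \<odot>\<^bsub>F\<^esub> f = a \<odot>\<^bsub>F\<^esub> (b \<odot>\<^bsub>F\<^esub> f)" by (simp add: ops K.m_assoc)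
  next
    fix a f g assume "a \<in> carrier K" "f \<in> carrier F" "g \<in> carrier F"
    note [simp] = this(1) closed[OF this(2)] closed[OF this(3)]
    show "a \<odot>\<^bsub>F\<^esub> (f \<oplus>\<^bsub>F\<^esub> g) = a \<odot>\<^bsub>F\<^esub> f \<oplus>\<^bsub>F\<^esub> a \<odot>\<^bsub>F\<^esub> g" by (simp add: ops K.r_distr)
  next
    fix f assume "f \<in> carrier F"
    note [simp] = closed[OF this]
    show "\<one> \<odot>\<^bsub>F\<^esub> f = f" by (simp add: ops)
  qed (rule smult_closed)
  then show ?thesis
    by (intro assoc_algebra.intro assoc_algebra_axioms.intro ring) (auto simp: smult_mult)
qed

lemma free_algebra_induct [consumes 1, case_names zero add]:
  assumes f: "f \<in> carrier F"
    and zero: "P \<zero>\<^bsub>F\<^esub>"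
    and add: "\<And>c w f. c \<in> carrier K \<Longrightarrow> set w \<subseteq> X \<Longrightarrow> f \<in> carrier F \<Longrightarrow> P f
      \<Longrightarrow> P (c \<odot>\<^bsub>F\<^esub> word K w \<oplus>\<^bsub>F\<^esub> f)"
  shows "P f"
proof -
  have "\<And>f. f \<in> carrier F \<Longrightarrow> {w. f w \<noteq> \<zero>} \<subseteq> S \<Longrightarrow> P f" if "finite S" for S
    using that
  proof (induction S)
    case empty
    then have "f = \<zero>\<^bsub>F\<^esub>" by (auto simp: ops)
    then show ?case by (simp add: zero)
  next
    case (insert u S)
    note f = insert.prems(1)
    note [simp] = closed[OF f]
    show ?case
    proof (cases "f u = \<zero>")
      case True
      then show ?thesis using insert by auto
    next
      case False
      define g where "g = f(u := \<zero>)"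
      have g: "g \<in> carrier F"
        by (rule carrierI[where S = "{w. f w \<noteq> \<zero>}"])
          (auto simp: g_def f support(1) dest: support(2)[OF f] split: if_splits)
      have "{w. g w \<noteq> \<zero>} \<subseteq> S" using insert.prems(2) by (auto simp: g_def)
      then have "P g" using insert.IH g by blast
      then have "P (f u \<odot>\<^bsub>F\<^esub> word K u \<oplus>\<^bsub>F\<^esub> g)"
        using add[of "f u" u g] f g support(2)[OF f False] by simp
      moreover have "f u \<odot>\<^bsub>F\<^esub> word K u \<oplus>\<^bsub>F\<^esub> g = f"
        using f by (auto simp: ops g_def word_def fun_eq_iff)
      ultimately show ?thesis by simp
    qed
  qed
  then show ?thesis using support(1)[OF f] f by blast
qed

end


section \<open>Algebra homomorphisms\<close>

lemma alg_homI:
  assumes "\<And>x. x \<in> carrier A \<Longrightarrow> h x \<in> carrier B"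
    and "\<And>x y. x \<in> carrier A \<Longrightarrow> y \<in> carrier A \<Longrightarrow> h (x \<otimes>\<^bsub>A\<^esub> y) = h x \<otimes>\<^bsub>B\<^esub> h y"
    and "\<And>x y. x \<in> carrier A \<Longrightarrow> y \<in> carrier A \<Longrightarrow> h (x \<oplus>\<^bsub>A\<^esub> y) = h x \<oplus>\<^bsub>B\<^esub> h y"
    and "h \<one>\<^bsub>A\<^esub> = \<one>\<^bsub>B\<^esub>"
    and "\<And>a x. a \<in> carrier K \<Longrightarrow> x \<in> carrier A \<Longrightarrow> h (a \<odot>\<^bsub>A\<^esub> x) = a \<odot>\<^bsub>B\<^esub> h x"
  shows "h \<in> alg_hom K A B"
  using assms by (auto simp: alg_hom_def ring_hom_def)

lemma alg_homD:
  assumes "h \<in> alg_hom K A B"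
  shows "x \<in> carrier A \<Longrightarrow> h x \<in> carrier B"
    and "x \<in> carrier A \<Longrightarrow> y \<in> carrier A \<Longrightarrow> h (x \<otimes>\<^bsub>A\<^esub> y) = h x \<otimes>\<^bsub>B\<^esub> h y"
    and "x \<in> carrier A \<Longrightarrow> y \<in> carrier A \<Longrightarrow> h (x \<oplus>\<^bsub>A\<^esub> y) = h x \<oplus>\<^bsub>B\<^esub> h y"
    and "h \<one>\<^bsub>A\<^esub> = \<one>\<^bsub>B\<^esub>"
    and "a \<in> carrier K \<Longrightarrow> x \<in> carrier A \<Longrightarrow> h (a \<odot>\<^bsub>A\<^esub> x) = a \<odot>\<^bsub>B\<^esub> h x"
  using assms by (auto simp: alg_hom_def ring_hom_def)

lemma alg_hom_ring_hom: "h \<in> alg_hom K A B \<Longrightarrow> h \<in> ring_hom A B"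
  by (simp add: alg_hom_def)

lemma alg_hom_compose:
  "g \<in> alg_hom K A B \<Longrightarrow> h \<in> alg_hom K B C \<Longrightarrow> (\<lambda>x. h (g x)) \<in> alg_hom K A C"
  by (rule alg_homI) (simp_all add: alg_homD)

lemma alg_hom_diff:
  assumes "assoc_algebra K A" "assoc_algebra K B" "h \<in> alg_hom K A B" "x \<in> carrier A" "y \<in> carrier A"
  shows "h (x \<ominus>\<^bsub>A\<^esub> y) = h x \<ominus>\<^bsub>B\<^esub> h y"
proof -
  interpret A: assoc_algebra K A by fact
  interpret B: assoc_algebra K B by fact
  interpret ring_hom_ring A B h
    by (intro ring_hom_ringI2 A.A.ring_axioms B.A.ring_axioms alg_hom_ring_hom[OF assms(3)])
  show ?thesis using assms by (simp add: a_minus_def)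
qed


section \<open>Universal property of the free algebra\<close>

locale free_alg_eval = free_alg K X F + C: assoc_algebra K C
  for K (structure) and X :: "'x set" and F (structure) and C (structure) and \<phi> :: "'x \<Rightarrow> 'c" +
  assumes phi: "\<And>x. x \<in> X \<Longrightarrow> \<phi> x \<in> carrier C"
begin

definition wprod :: "'x list \<Rightarrow> 'c"
  where "wprod w = foldr (\<lambda>x p. \<phi> x \<otimes>\<^bsub>C\<^esub> p) w \<one>\<^bsub>C\<^esub>"

definition ev :: "('x list \<Rightarrow> 'a) \<Rightarrow> 'c"
  where "ev f = (\<Oplus>\<^bsub>C\<^esub>w\<in>{w. f w \<noteq> \<zero>}. f w \<odot>\<^bsub>C\<^esub> wprod w)"

lemma wprod_closed: "set w \<subseteq> X \<Longrightarrow> wprod w \<in> carrier C"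
  by (induction w) (auto simp: wprod_def phi)

lemma wprod_append: "set u \<subseteq> X \<Longrightarrow> set v \<subseteq> X \<Longrightarrow> wprod (u @ v) = wprod u \<otimes>\<^bsub>C\<^esub> wprod v"
proof (induction u)
  case Nil
  then show ?case using wprod_closed[of v] by (simp add: wprod_def)
next
  case (Cons x u)
  then show ?case using wprod_closed[of v] wprod_closed[of u] phi[of x]
    by (simp add: wprod_def C.A.m_assoc)
qed

lemma smult_null: "x \<in> carrier C \<Longrightarrow> \<zero> \<odot>\<^bsub>C\<^esub> x = \<zero>\<^bsub>C\<^esub>"
  by (rule C.V.smult_l_null)

lemma ev_superset:
  assumes "f \<in> carrier F" "finite S" "{w. f w \<noteq> \<zero>} \<subseteq> S" "\<And>w. w \<in> S \<Longrightarrow> set w \<subseteq> X"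
  shows "ev f = (\<Oplus>\<^bsub>C\<^esub>w\<in>S. f w \<odot>\<^bsub>C\<^esub> wprod w)"
  unfolding ev_def
  using assms closed[OF assms(1)]
  by (intro C.V.M.add.finprod_mono_neutral_cong_left) (auto simp: smult_null wprod_closed)

lemma ev_closed: "f \<in> carrier F \<Longrightarrow> ev f \<in> carrier C"
  unfolding ev_def using support(2)[of f] closed[of f]
  by (intro C.V.M.finsum_closed) (auto intro!: C.V.smult_closed wprod_closed)

lemma ev_word: "set w \<subseteq> X \<Longrightarrow> ev (word K w) = wprod w"
proof -
  assume w: "set w \<subseteq> X"
  have "ev (word K w) = (\<Oplus>\<^bsub>C\<^esub>v\<in>{w}. word K w v \<odot>\<^bsub>C\<^esub> wprod v)"
    using w by (intro ev_superset word_closed) (auto simp: word_def split: if_splits)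
  also have "\<dots> = wprod w"
    using wprod_closed[OF w] by (simp add: word_def)
  finally show ?thesis .
qed

lemma ev_zero: "ev \<zero>\<^bsub>F\<^esub> = \<zero>\<^bsub>C\<^esub>"
  by (simp add: ev_def ops)

lemma ev_add:
  assumes f: "f \<in> carrier F" and g: "g \<in> carrier F"
  shows "ev (f \<oplus>\<^bsub>F\<^esub> g) = ev f \<oplus>\<^bsub>C\<^esub> ev g"
proof -
  note [simp] = closed[OF f] closed[OF g]
  define S where "S = {w. f w \<noteq> \<zero>} \<union> {w. g w \<noteq> \<zero>}"
  have fin: "finite S" using support(1)[OF f] support(1)[OF g] by (simp add: S_def)
  have S: "set w \<subseteq> X" if "w \<in> S" for w
    using that support(2)[OF f] support(2)[OF g] by (auto simp: S_def)
  have sub: "{w. f w \<noteq> \<zero>} \<subseteq> S" "{w. g w \<noteq> \<zero>} \<subseteq> S" "{w. (f \<oplus>\<^bsub>F\<^esub> g) w \<noteq> \<zero>} \<subseteq> S"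
    by (auto simp: S_def ops)
  have cl: "f w \<odot>\<^bsub>C\<^esub> wprod w \<in> carrier C" "g w \<odot>\<^bsub>C\<^esub> wprod w \<in> carrier C" if "w \<in> S" for w
    using wprod_closed[OF S[OF that]] by simp_all
  have "ev (f \<oplus>\<^bsub>F\<^esub> g) = (\<Oplus>\<^bsub>C\<^esub>w\<in>S. (f \<oplus>\<^bsub>F\<^esub> g) w \<odot>\<^bsub>C\<^esub> wprod w)"
    by (rule ev_superset[OF add_closed[OF f g] fin sub(3) S])
  also have "\<dots> = (\<Oplus>\<^bsub>C\<^esub>w\<in>S. f w \<odot>\<^bsub>C\<^esub> wprod w \<oplus>\<^bsub>C\<^esub> g w \<odot>\<^bsub>C\<^esub> wprod w)"
    by (intro C.V.M.finsum_cong') (simp_all add: ops cl C.V.smult_l_distr wprod_closed S)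
  also have "\<dots> = (\<Oplus>\<^bsub>C\<^esub>w\<in>S. f w \<odot>\<^bsub>C\<^esub> wprod w) \<oplus>\<^bsub>C\<^esub> (\<Oplus>\<^bsub>C\<^esub>w\<in>S. g w \<odot>\<^bsub>C\<^esub> wprod w)"
    by (intro C.V.M.finsum_addf) (simp_all add: cl)
  also have "\<dots> = ev f \<oplus>\<^bsub>C\<^esub> ev g"
    using ev_superset[OF f fin sub(1) S] ev_superset[OF g fin sub(2) S] by simp
  finally show ?thesis .
qed

lemma ev_smult_word:
  assumes c: "c \<in> carrier K" and w: "set w \<subseteq> X"
  shows "ev (c \<odot>\<^bsub>F\<^esub> word K w) = c \<odot>\<^bsub>C\<^esub> wprod w"
proof -
  have "ev (c \<odot>\<^bsub>F\<^esub> word K w) = (\<Oplus>\<^bsub>C\<^esub>v\<in>{w}. (c \<odot>\<^bsub>F\<^esub> word K w) v \<odot>\<^bsub>C\<^esub> wprod v)"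
    using w c by (intro ev_superset smult_closed word_closed) (auto simp: ops word_def split: if_splits)
  also have "\<dots> = c \<odot>\<^bsub>C\<^esub> wprod w"
    using wprod_closed[OF w] c by (simp add: word_def ops)
  finally show ?thesis .
qed

lemma ev_hom: "ev \<in> alg_hom K F C"
proof (rule alg_homI)
  interpret F: assoc_algebra K F by (rule assoc_algebra)
  note wc = wprod_closed word_closed ev_closed
  show "ev f \<in> carrier C" if "f \<in> carrier F" for f using that by (rule ev_closed)
  show "ev (f \<oplus>\<^bsub>F\<^esub> g) = ev f \<oplus>\<^bsub>C\<^esub> ev g" if "f \<in> carrier F" "g \<in> carrier F" for f g
    using that by (rule ev_add)
  show "ev \<one>\<^bsub>F\<^esub> = \<one>\<^bsub>C\<^esub>" by (simp add: one_word ev_word) (simp add: wprod_def)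
  show sm: "ev (a \<odot>\<^bsub>F\<^esub> f) = a \<odot>\<^bsub>C\<^esub> ev f" if "a \<in> carrier K" "f \<in> carrier F" for a f
    using that(2)
  proof (induction f rule: free_algebra_induct)
    case zero
    then show ?case using that by (simp add: ev_zero)
  next
    case (add c w f)
    then show ?case using that
      by (simp add: F.smult_r_distr ev_add ev_smult_word wc C.V.smult_r_distr C.V.smult_assoc1
          F.smult_assoc1[symmetric])
  qed
  have mw: "ev (word K u \<otimes>\<^bsub>F\<^esub> g) = wprod u \<otimes>\<^bsub>C\<^esub> ev g" if "set u \<subseteq> X" "g \<in> carrier F" for u g
    using that(2)
  proof (induction g rule: free_algebra_induct)
    case zero
    then show ?case using that by (simp add: ev_zero wc)
  next
    case (add c w f)
    then show ?case using that
      by (simp add: F.A.r_distr ev_add sm ev_word wc C.A.r_distr F.smult_mult_right word_mult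
          wprod_append C.smult_mult_right)
  qed
  show "ev (f \<otimes>\<^bsub>F\<^esub> g) = ev f \<otimes>\<^bsub>C\<^esub> ev g" if "f \<in> carrier F" "g \<in> carrier F" for f g
    using that(1)
  proof (induction f rule: free_algebra_induct)
    case zero
    then show ?case using that by (simp add: ev_zero wc)
  next
    case (add c w f)
    then show ?case using that
      by (simp add: F.A.l_distr ev_add sm ev_word wc C.A.l_distr F.smult_mult_left mw
          C.smult_mult_left)
  qed
qed

lemma ev_gen: "x \<in> X \<Longrightarrow> ev (word K [x]) = \<phi> x"
  by (simp add: ev_word) (simp add: wprod_def phi)

end

theorem free_algebra_assoc_algebra:
  "cring K \<Longrightarrow> assoc_algebra K (free_algebra K X)"
  by (rule free_alg.assoc_algebra) (simp_all add: free_alg_def)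

theorem free_algebra_universal:
  assumes "assoc_algebra K C" and "\<And>x. x \<in> X \<Longrightarrow> \<phi> x \<in> carrier C"
  shows "\<exists>h\<in>alg_hom K (free_algebra K X) C. \<forall>x\<in>X. h (word K [x]) = \<phi> x"
proof -
  interpret C: assoc_algebra K C by fact
  interpret free_alg_eval K X "free_algebra K X" C \<phi>
    by unfold_locales (use assms in auto)
  show ?thesis using ev_hom ev_gen by blast
qed

theorem free_algebra_hom_unique:
  assumes C: "assoc_algebra K C"
    and g: "g \<in> alg_hom K (free_algebra K X) C" and h: "h \<in> alg_hom K (free_algebra K X) C"
    and eq: "\<And>x. x \<in> X \<Longrightarrow> g (word K [x]) = h (word K [x])"
    and f: "f \<in> carrier (free_algebra K X)"
  shows "g f = h f"
proof -
  interpret C: assoc_algebra K C by fact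
  define F where "F = free_algebra K X"
  interpret free_alg K X F by unfold_locales (simp add: F_def)
  interpret F: assoc_algebra K F by (rule assoc_algebra)
  have g: "g \<in> alg_hom K F C" and h: "h \<in> alg_hom K F C" using g h by (simp_all add: F_def)
  note G = alg_homD[OF g] and H = alg_homD[OF h]
  have w: "g (word K w) = h (word K w)" if "set w \<subseteq> X" for w
    using that
  proof (induction w)
    case Nil
    then show ?case using G(4) H(4) by (simp add: one_word)
  next
    case (Cons x w)
    have "word K (x # w) = word K [x] \<otimes>\<^bsub>F\<^esub> word K w" by (simp add: word_mult)
    then show ?case using Cons by (simp add: G(2) H(2) word_closed eq)
  qed
  have "f \<in> carrier F" using f by (simp add: F_def)
  then show ?thesis
  proof (induction f rule: free_algebra_induct)
    case zero
    have "g (\<zero>\<^bsub>K\<^esub> \<odot>\<^bsub>F\<^esub> word K []) = h (\<zero>\<^bsub>K\<^esub> \<odot>\<^bsub>F\<^esub> word K [])"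
      using G(5)[of "\<zero>\<^bsub>K\<^esub>" "word K []"] H(5)[of "\<zero>\<^bsub>K\<^esub>" "word K []"] w[of "[]"] word_closed[of "[]"] by simp
    then show ?case using word_closed[of "[]"] by simp
  next
    case (add c u f)
    then show ?case by (simp add: G(3,5) H(3,5) word_closed w)
  qed
qed


section \<open>Quotient algebras\<close>

locale alg_ideal = A: assoc_algebra K A + I: ideal I A for K (structure) and A (structure) and I
begin

lemma smult_I: "a \<in> carrier K \<Longrightarrow> i \<in> I \<Longrightarrow> a \<odot>\<^bsub>A\<^esub> i \<in> I"
proof -
  assume a: "a \<in> carrier K" and i: "i \<in> I"
  have "(a \<odot>\<^bsub>A\<^esub> \<one>\<^bsub>A\<^esub>) \<otimes>\<^bsub>A\<^esub> i \<in> I"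
    using a i by (intro I.I_l_closed) auto
  then show ?thesis using a i I.Icarr[OF i] by (simp add: A.smult_mult_left)
qed

lemma mem_coset: "y \<in> I +>\<^bsub>A\<^esub> x \<longleftrightarrow> (\<exists>i\<in>I. y = i \<oplus>\<^bsub>A\<^esub> x)"
  by (auto simp: a_r_coset_def')

lemma coset_absorb: "i \<in> I \<Longrightarrow> x \<in> carrier A \<Longrightarrow> I +>\<^bsub>A\<^esub> (i \<oplus>\<^bsub>A\<^esub> x) = I +>\<^bsub>A\<^esub> x"
  by (rule I.a_repr_independence'[symmetric]) (auto simp: mem_coset I.Icarr)

lemma smult_coset:
  assumes a: "a \<in> carrier K" and x: "x \<in> carrier A"
  shows "(\<Union>y\<in>I +>\<^bsub>A\<^esub> x. I +>\<^bsub>A\<^esub> (a \<odot>\<^bsub>A\<^esub> y)) = I +>\<^bsub>A\<^esub> (a \<odot>\<^bsub>A\<^esub> x)"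
proof -
  have "I +>\<^bsub>A\<^esub> (a \<odot>\<^bsub>A\<^esub> y) = I +>\<^bsub>A\<^esub> (a \<odot>\<^bsub>A\<^esub> x)" if y: "y \<in> I +>\<^bsub>A\<^esub> x" for y
  proof -
    obtain i where i: "i \<in> I" "y = i \<oplus>\<^bsub>A\<^esub> x" using y by (auto simp: mem_coset)
    then have "a \<odot>\<^bsub>A\<^esub> y = a \<odot>\<^bsub>A\<^esub> i \<oplus>\<^bsub>A\<^esub> a \<odot>\<^bsub>A\<^esub> x"
      using a x I.Icarr by (simp add: A.smult_r_distr)
    then show ?thesis using coset_absorb smult_I a i x by simp
  qed
  moreover have "x \<in> I +>\<^bsub>A\<^esub> x"
    using x I.a_rcos_self by blast
  ultimately show ?thesis by blast
qed

abbreviation "Q \<equiv> quot_algebra A I"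

lemma Q_carrier: "D \<in> carrier Q \<longleftrightarrow> (\<exists>x\<in>carrier A. D = I +>\<^bsub>A\<^esub> x)"
  by (auto simp: quot_algebra_def FactRing_def A_RCOSETS_def')

lemma Q_ops:
  "x \<in> carrier A \<Longrightarrow> y \<in> carrier A \<Longrightarrow> (I +>\<^bsub>A\<^esub> x) \<oplus>\<^bsub>Q\<^esub> (I +>\<^bsub>A\<^esub> y) = I +>\<^bsub>A\<^esub> (x \<oplus>\<^bsub>A\<^esub> y)"
  "x \<in> carrier A \<Longrightarrow> y \<in> carrier A \<Longrightarrow> (I +>\<^bsub>A\<^esub> x) \<otimes>\<^bsub>Q\<^esub> (I +>\<^bsub>A\<^esub> y) = I +>\<^bsub>A\<^esub> (x \<otimes>\<^bsub>A\<^esub> y)"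
  "a \<in> carrier K \<Longrightarrow> x \<in> carrier A \<Longrightarrow> a \<odot>\<^bsub>Q\<^esub> (I +>\<^bsub>A\<^esub> x) = I +>\<^bsub>A\<^esub> (a \<odot>\<^bsub>A\<^esub> x)"
  "\<one>\<^bsub>Q\<^esub> = I +>\<^bsub>A\<^esub> \<one>\<^bsub>A\<^esub>"
  by (simp_all add: quot_algebra_def FactRing_def I.a_rcos_sum I.rcoset_mult_add smult_coset)

lemma proj_hom: "(\<lambda>x. I +>\<^bsub>A\<^esub> x) \<in> alg_hom K A Q"
  by (rule alg_homI) (auto simp: Q_ops Q_carrier)

lemma Q_ring: "ring Q"
proof -
  interpret R: ring "A Quot I" by (rule I.quotient_is_ring)
  have c: "carrier Q = carrier (A Quot I)" "mult Q = mult (A Quot I)" "one Q = one (A Quot I)"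
    "zero Q = zero (A Quot I)" "add Q = add (A Quot I)"
    by (simp_all add: quot_algebra_def)
  show ?thesis
  proof (rule ringI)
    show "abelian_group Q"
    proof (rule abelian_groupI)
      show "\<exists>y\<in>carrier Q. y \<oplus>\<^bsub>Q\<^esub> x = \<zero>\<^bsub>Q\<^esub>" if "x \<in> carrier Q" for x
        using that R.l_neg R.a_inv_closed unfolding c by blast
      show "x \<oplus>\<^bsub>Q\<^esub> y = y \<oplus>\<^bsub>Q\<^esub> x" if "x \<in> carrier Q" "y \<in> carrier Q" for x y
        using that R.a_comm unfolding c by blast
      show "x \<oplus>\<^bsub>Q\<^esub> y \<oplus>\<^bsub>Q\<^esub> z = x \<oplus>\<^bsub>Q\<^esub> (y \<oplus>\<^bsub>Q\<^esub> z)"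
        if "x \<in> carrier Q" "y \<in> carrier Q" "z \<in> carrier Q" for x y z
        using that R.a_assoc unfolding c by blast
    qed (simp_all add: c)
    show "Group.monoid Q" by (rule monoidI) (auto simp: c R.m_assoc)
  qed (auto simp: c R.l_distr R.r_distr)
qed

lemma quot_assoc_algebra: "assoc_algebra K Q"
proof -
  interpret Q: ring Q by (rule Q_ring)
  have "module K Q"
    by (rule moduleI[OF A.V.R.is_cring Q.abelian_group_axioms])
      (auto simp: Q_carrier Q_ops A.smult_l_distr A.smult_r_distr A.smult_assoc1)
  then show ?thesis
    by (intro assoc_algebra.intro assoc_algebra_axioms.intro Q_ring)
      (auto simp: Q_carrier Q_ops A.smult_mult_left A.smult_mult_right)
qed

lemma quot_universal:
  assumes C: "assoc_algebra K C" and h: "h \<in> alg_hom K A C"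
    and ker: "\<And>x. x \<in> I \<Longrightarrow> h x = \<zero>\<^bsub>C\<^esub>"
  shows "\<exists>g\<in>alg_hom K Q C. \<forall>x\<in>carrier A. g (I +>\<^bsub>A\<^esub> x) = h x"
proof -
  interpret C: assoc_algebra K C by fact
  note H = alg_homD[OF h]
  define g where "g D = h (SOME x. x \<in> D)" for D
  have g: "g (I +>\<^bsub>A\<^esub> x) = h x" if x: "x \<in> carrier A" for x
  proof -
    define y where "y = (SOME y. y \<in> I +>\<^bsub>A\<^esub> x)"
    have "y \<in> I +>\<^bsub>A\<^esub> x"
      unfolding y_def by (rule someI[of _ x]) (rule I.a_rcos_self[OF x])
    then obtain i where i: "i \<in> I" "y = i \<oplus>\<^bsub>A\<^esub> x" unfolding mem_coset by blast
    have "g (I +>\<^bsub>A\<^esub> x) = h y" by (simp add: g_def y_def)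
    then show ?thesis using x i ker[OF i(1)] I.Icarr[OF i(1)] by (simp add: H(1,3))
  qed
  have "g \<in> alg_hom K Q C"
    by (rule alg_homI) (auto simp: Q_carrier Q_ops g H)
  then show ?thesis using g by blast
qed

end


section \<open>Universal property of the free product\<close>

lemma incl_relsI:
  "x \<in> carrier A \<Longrightarrow> y \<in> carrier A
    \<Longrightarrow> word K [j (x \<oplus>\<^bsub>A\<^esub> y)] \<ominus>\<^bsub>F\<^esub> (word K [j x] \<oplus>\<^bsub>F\<^esub> word K [j y]) \<in> incl_rels K F A j"
  "x \<in> carrier A \<Longrightarrow> y \<in> carrier A
    \<Longrightarrow> word K [j (x \<otimes>\<^bsub>A\<^esub> y)] \<ominus>\<^bsub>F\<^esub> (word K [j x] \<otimes>\<^bsub>F\<^esub> word K [j y]) \<in> incl_rels K F A j"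
  "a \<in> carrier K \<Longrightarrow> x \<in> carrier A
    \<Longrightarrow> word K [j (a \<odot>\<^bsub>A\<^esub> x)] \<ominus>\<^bsub>F\<^esub> (a \<odot>\<^bsub>F\<^esub> word K [j x]) \<in> incl_rels K F A j"
  "word K [j \<one>\<^bsub>A\<^esub>] \<ominus>\<^bsub>F\<^esub> \<one>\<^bsub>F\<^esub> \<in> incl_rels K F A j"
  unfolding incl_rels_def by blast+

lemma incl_rels_vanish:
  assumes A: "assoc_algebra K A" and F: "assoc_algebra K F" and C: "assoc_algebra K C"
    and H: "H \<in> alg_hom K F C" and f: "f \<in> alg_hom K A C"
    and gen: "\<And>x. x \<in> carrier A \<Longrightarrow> word K [j x] \<in> carrier F"
    and Hf: "\<And>x. x \<in> carrier A \<Longrightarrow> H (word K [j x]) = f x"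
    and r: "r \<in> incl_rels K F A j"
  shows "H r = \<zero>\<^bsub>C\<^esub>"
proof -
  interpret A: assoc_algebra K A by fact
  interpret F: assoc_algebra K F by fact
  interpret C: assoc_algebra K C by fact
  note HD = alg_homD[OF H] and fD = alg_homD[OF f]
  have eq: "H (u \<ominus>\<^bsub>F\<^esub> v) = \<zero>\<^bsub>C\<^esub>" if "u \<in> carrier F" "v \<in> carrier F" "H u = H v" for u v
  proof -
    have "H (u \<ominus>\<^bsub>F\<^esub> v) = H v \<ominus>\<^bsub>C\<^esub> H v"
      using alg_hom_diff[OF F C H that(1,2)] that(3) by simp
    also have "\<dots> = \<zero>\<^bsub>C\<^esub>"
      unfolding a_minus_def by (rule C.V.M.r_neg[OF HD(1)[OF that(2)]])
    finally show ?thesis .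
  qed
  from r consider
    (add) x y where "x \<in> carrier A" "y \<in> carrier A"
      "r = word K [j (x \<oplus>\<^bsub>A\<^esub> y)] \<ominus>\<^bsub>F\<^esub> (word K [j x] \<oplus>\<^bsub>F\<^esub> word K [j y])"
  | (mult) x y where "x \<in> carrier A" "y \<in> carrier A"
      "r = word K [j (x \<otimes>\<^bsub>A\<^esub> y)] \<ominus>\<^bsub>F\<^esub> (word K [j x] \<otimes>\<^bsub>F\<^esub> word K [j y])"
  | (smult) a x where "a \<in> carrier K" "x \<in> carrier A"
      "r = word K [j (a \<odot>\<^bsub>A\<^esub> x)] \<ominus>\<^bsub>F\<^esub> (a \<odot>\<^bsub>F\<^esub> word K [j x])"
  | (one) "r = word K [j \<one>\<^bsub>A\<^esub>] \<ominus>\<^bsub>F\<^esub> \<one>\<^bsub>F\<^esub>"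
    unfolding incl_rels_def by blast
  then show ?thesis
  proof cases
    case add
    show ?thesis unfolding add(3) using add(1,2) by (intro eq) (simp_all add: gen Hf HD(2-5) fD(2-5))
  next
    case mult
    show ?thesis unfolding mult(3) using mult(1,2) by (intro eq) (simp_all add: gen Hf HD(2-5) fD(2-5))
  next
    case smult
    show ?thesis unfolding smult(3) using smult(1,2) by (intro eq) (simp_all add: gen Hf HD(2-5) fD(2-5))
  next
    case one
    show ?thesis unfolding one by (intro eq) (simp_all add: gen Hf HD(2-5) fD(2-5))
  qed
qed

locale two_algebras = A: assoc_algebra K A + B: assoc_algebra K B
  for K (structure) and A (structure) and B (structure)
begin

abbreviation "F \<equiv> free_algebra K (carrier A <+> carrier B)"
abbreviation "rels \<equiv> incl_rels K F A Inl \<union> incl_rels K F B Inr"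
abbreviation "J \<equiv> free_product_ideal K A B"

sublocale FA: free_alg K "carrier A <+> carrier B" F
  by unfold_locales simp

sublocale FF: assoc_algebra K F
  by (rule FA.assoc_algebra)

lemma gens: "x \<in> carrier A \<Longrightarrow> word K [Inl x] \<in> carrier F" "y \<in> carrier B \<Longrightarrow> word K [Inr y] \<in> carrier F"
  by (auto intro!: FA.word_closed)

lemma rels_carrier: "rels \<subseteq> carrier F"
  by (auto simp: incl_rels_def gens intro!: FF.V.M.minus_closed FF.V.smult_closed)

lemma J_eq: "J = Idl\<^bsub>F\<^esub> rels"
  by (simp add: free_product_ideal_def Let_def)

sublocale Q: alg_ideal K F J
  using FF.A.genideal_ideal[OF rels_carrier]
  by (intro alg_ideal.intro FF.assoc_algebra_axioms) (simp add: J_eq)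

lemma rels_J: "r \<in> rels \<Longrightarrow> r \<in> J"
  using FF.A.genideal_self[OF rels_carrier] by (auto simp: J_eq)

lemma coset_eq:
  assumes "x \<ominus>\<^bsub>F\<^esub> y \<in> rels" "x \<in> carrier F" "y \<in> carrier F"
  shows "J +>\<^bsub>F\<^esub> x = J +>\<^bsub>F\<^esub> y"
proof -
  have "(x \<ominus>\<^bsub>F\<^esub> y) \<oplus>\<^bsub>F\<^esub> y = x"
    using assms by (simp add: a_minus_def FF.V.M.a_assoc FF.V.M.l_neg)
  then show ?thesis using Q.coset_absorb[OF rels_J[OF assms(1)] assms(3)] by simp
qed

theorem free_product_assoc_algebra: "assoc_algebra K (free_product K A B)"
  unfolding free_product_def by (rule Q.quot_assoc_algebra)

theorem free_product_inl_hom: "free_product_inl K A B \<in> alg_hom K A (free_product K A B)"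
  unfolding free_product_def free_product_inl_def
proof (rule alg_homI)
  fix x y assume xy: "x \<in> carrier A" "y \<in> carrier A"
  show "J +>\<^bsub>F\<^esub> word K [Inl (x \<otimes>\<^bsub>A\<^esub> y)] = (J +>\<^bsub>F\<^esub> word K [Inl x]) \<otimes>\<^bsub>Q.Q\<^esub> (J +>\<^bsub>F\<^esub> word K [Inl y])"
    using xy by (subst Q.Q_ops, simp_all add: gens, intro coset_eq)
      (simp_all add: gens incl_relsI)
  show "J +>\<^bsub>F\<^esub> word K [Inl (x \<oplus>\<^bsub>A\<^esub> y)] = (J +>\<^bsub>F\<^esub> word K [Inl x]) \<oplus>\<^bsub>Q.Q\<^esub> (J +>\<^bsub>F\<^esub> word K [Inl y])"
    using xy by (subst Q.Q_ops, simp_all add: gens, intro coset_eq)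
      (simp_all add: gens incl_relsI)
next
  show "J +>\<^bsub>F\<^esub> word K [Inl \<one>\<^bsub>A\<^esub>] = \<one>\<^bsub>Q.Q\<^esub>"
    by (subst Q.Q_ops, intro coset_eq) (simp_all add: gens incl_relsI)
next
  fix a x assume ax: "a \<in> carrier K" "x \<in> carrier A"
  show "J +>\<^bsub>F\<^esub> word K [Inl (a \<odot>\<^bsub>A\<^esub> x)] = a \<odot>\<^bsub>Q.Q\<^esub> (J +>\<^bsub>F\<^esub> word K [Inl x])"
    using ax by (subst Q.Q_ops, simp_all add: gens, intro coset_eq)
      (simp_all add: gens incl_relsI)
next
  show "J +>\<^bsub>F\<^esub> word K [Inl x] \<in> carrier Q.Q" if "x \<in> carrier A" for x
    using that gens by (auto simp: Q.Q_carrier)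
qed

theorem free_product_inr_hom: "free_product_inr K A B \<in> alg_hom K B (free_product K A B)"
  unfolding free_product_def free_product_inr_def
proof (rule alg_homI)
  fix x y assume xy: "x \<in> carrier B" "y \<in> carrier B"
  show "J +>\<^bsub>F\<^esub> word K [Inr (x \<otimes>\<^bsub>B\<^esub> y)] = (J +>\<^bsub>F\<^esub> word K [Inr x]) \<otimes>\<^bsub>Q.Q\<^esub> (J +>\<^bsub>F\<^esub> word K [Inr y])"
    using xy by (subst Q.Q_ops, simp_all add: gens, intro coset_eq)
      (simp_all add: gens incl_relsI)
  show "J +>\<^bsub>F\<^esub> word K [Inr (x \<oplus>\<^bsub>B\<^esub> y)] = (J +>\<^bsub>F\<^esub> word K [Inr x]) \<oplus>\<^bsub>Q.Q\<^esub> (J +>\<^bsub>F\<^esub> word K [Inr y])"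
    using xy by (subst Q.Q_ops, simp_all add: gens, intro coset_eq)
      (simp_all add: gens incl_relsI)
next
  show "J +>\<^bsub>F\<^esub> word K [Inr \<one>\<^bsub>B\<^esub>] = \<one>\<^bsub>Q.Q\<^esub>"
    by (subst Q.Q_ops, intro coset_eq) (simp_all add: gens incl_relsI)
next
  fix a x assume ax: "a \<in> carrier K" "x \<in> carrier B"
  show "J +>\<^bsub>F\<^esub> word K [Inr (a \<odot>\<^bsub>B\<^esub> x)] = a \<odot>\<^bsub>Q.Q\<^esub> (J +>\<^bsub>F\<^esub> word K [Inr x])"
    using ax by (subst Q.Q_ops, simp_all add: gens, intro coset_eq)
      (simp_all add: gens incl_relsI)
next
  show "J +>\<^bsub>F\<^esub> word K [Inr x] \<in> carrier Q.Q" if "x \<in> carrier B" for x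
    using that gens by (auto simp: Q.Q_carrier)
qed

theorem free_product_universal:
  assumes C: "assoc_algebra K C" and f: "f \<in> alg_hom K A C" and g: "g \<in> alg_hom K B C"
  shows "\<exists>h\<in>alg_hom K (free_product K A B) C.
    (\<forall>x\<in>carrier A. h (free_product_inl K A B x) = f x) \<and>
    (\<forall>y\<in>carrier B. h (free_product_inr K A B y) = g y)"
proof -
  interpret C: assoc_algebra K C by fact
  note fD = alg_homD[OF f] and gD = alg_homD[OF g]
  have "case_sum f g z \<in> carrier C" if "z \<in> carrier A <+> carrier B" for z
    using that fD(1) gD(1) by (auto split: sum.split)
  from free_algebra_universal[OF C, of "carrier A <+> carrier B" "case_sum f g", OF this]
  obtain H where H: "H \<in> alg_hom K F C"
    and Hgen: "\<And>z. z \<in> carrier A <+> carrier B \<Longrightarrow> H (word K [z]) = case_sum f g z"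
    by blast
  have Hl: "H (word K [Inl x]) = f x" if "x \<in> carrier A" for x using that Hgen[of "Inl x"] by auto
  have Hr: "H (word K [Inr y]) = g y" if "y \<in> carrier B" for y using that Hgen[of "Inr y"] by auto
  interpret H: ring_hom_ring F C H
    by (intro ring_hom_ringI2 FF.A.ring_axioms C.A.ring_axioms alg_hom_ring_hom[OF H])
  have "H r = \<zero>\<^bsub>C\<^esub>" if r: "r \<in> rels" for r
    using r
  proof
    assume "r \<in> incl_rels K F A Inl"
    then show ?thesis
      by (intro incl_rels_vanish[where j = Inl and r = r, OF A.assoc_algebra_axioms FF.assoc_algebra_axioms C H f])
        (simp_all add: gens Hl)
  next
    assume "r \<in> incl_rels K F B Inr"
    then show ?thesis
      by (intro incl_rels_vanish[where j = Inr and r = r, OF B.assoc_algebra_axioms FF.assoc_algebra_axioms C H g])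
        (simp_all add: gens Hr)
  qed
  then have "rels \<subseteq> {x \<in> carrier F. H x = \<zero>\<^bsub>C\<^esub>}"
    using rels_carrier by blast
  then have "J \<subseteq> {x \<in> carrier F. H x = \<zero>\<^bsub>C\<^esub>}"
    unfolding J_eq
    by (rule FF.A.genideal_minimal[OF H.kernel_is_ideal[unfolded a_kernel_def']])
  then have "\<And>x. x \<in> J \<Longrightarrow> H x = \<zero>\<^bsub>C\<^esub>" by blast
  from Q.quot_universal[OF C H this]
  obtain h where "h \<in> alg_hom K Q.Q C" "\<And>x. x \<in> carrier F \<Longrightarrow> h (J +>\<^bsub>F\<^esub> x) = H x" by blast
  then show ?thesis
    unfolding free_product_def free_product_inl_def free_product_inr_def
    by (intro bexI[of _ h] conjI ballI) (simp_all add: gens Hl Hr)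
qed

theorem free_product_hom_unique:
  assumes C: "assoc_algebra K C"
    and h: "h \<in> alg_hom K (free_product K A B) C" and h': "h' \<in> alg_hom K (free_product K A B) C"
    and l: "\<And>x. x \<in> carrier A \<Longrightarrow> h (free_product_inl K A B x) = h' (free_product_inl K A B x)"
    and r: "\<And>y. y \<in> carrier B \<Longrightarrow> h (free_product_inr K A B y) = h' (free_product_inr K A B y)"
    and p: "p \<in> carrier (free_product K A B)"
  shows "h p = h' p"
proof -
  obtain x where x: "x \<in> carrier F" "p = J +>\<^bsub>F\<^esub> x"
    using p by (auto simp: free_product_def Q.Q_carrier)
  have pr: "(\<lambda>x. J +>\<^bsub>F\<^esub> x) \<in> alg_hom K F (free_product K A B)"
    unfolding free_product_def by (rule Q.proj_hom)
  have "h (J +>\<^bsub>F\<^esub> x) = h' (J +>\<^bsub>F\<^esub> x)"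
    by (rule free_algebra_hom_unique[OF C alg_hom_compose[OF pr h] alg_hom_compose[OF pr h'] _ x(1)])
      (use l r in \<open>auto simp: free_product_inl_def free_product_inr_def\<close>)
  then show ?thesis by (simp add: x)
qed

end

text \<open>The polynomial algebra \<^term>\<open>UP K\<close> is an algebra in the above sense.\<close>

lemma UP_assoc_algebra:
  assumes "cring K"
  shows "assoc_algebra K (UP K)"
proof -
  interpret UP_cring K "UP K" using assms by (simp_all add: UP_cring_def)
  have alg: "algebra K (UP K)" by (rule UP_algebra)
  then have mod: "module K (UP K)" by (simp add: algebra_def)
  have ring: "ring (UP K)" by (rule UP_ring)
  have comm: "x \<otimes>\<^bsub>UP K\<^esub> y = y \<otimes>\<^bsub>UP K\<^esub> x" if "x \<in> carrier (UP K)" "y \<in> carrier (UP K)" for x y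
    using that by (rule UP_m_comm)
  have left: "(a \<odot>\<^bsub>UP K\<^esub> x) \<otimes>\<^bsub>UP K\<^esub> y = a \<odot>\<^bsub>UP K\<^esub> (x \<otimes>\<^bsub>UP K\<^esub> y)"
    if "a \<in> carrier K" "x \<in> carrier (UP K)" "y \<in> carrier (UP K)" for a x y
    by (rule algebra.smult_assoc2[OF alg that])
  show ?thesis
  proof (intro assoc_algebra.intro assoc_algebra_axioms.intro mod ring left)
    fix a x y assume h: "a \<in> carrier K" "x \<in> carrier (UP K)" "y \<in> carrier (UP K)"
    have "x \<otimes>\<^bsub>UP K\<^esub> (a \<odot>\<^bsub>UP K\<^esub> y) = (a \<odot>\<^bsub>UP K\<^esub> y) \<otimes>\<^bsub>UP K\<^esub> x"
      using h by (intro comm module.smult_closed[OF mod])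
    also have "\<dots> = a \<odot>\<^bsub>UP K\<^esub> (x \<otimes>\<^bsub>UP K\<^esub> y)"
      using h by (simp only: left comm[of y x])
    finally show "x \<otimes>\<^bsub>UP K\<^esub> (a \<odot>\<^bsub>UP K\<^esub> y) = a \<odot>\<^bsub>UP K\<^esub> (x \<otimes>\<^bsub>UP K\<^esub> y)" .
  qed
qed

end

theory Submission
  imports Defs
begin

text \<open>
  Let \<open>G = K\<langle>x, y\<rangle>\<close> be the free product of \<open>R\<close> and \<open>K[z]\<close>, let \<open>\<epsilon>\<close> be the constant term and \<open>M\<close> the
  kernel of \<open>\<epsilon>\<close> on \<open>R\<close>. The augmentation ideal \<open>\<omega>\<close> of \<open>G\<close> is a free right module on \<open>x\<close> and \<open>y\<close>. On
  the other hand it is \<open>M G \<oplus> z G\<close>, once \<open>z\<close> is translated to satisfy \<open>\<epsilon> z = 0\<close>. Tensoring with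
  the retraction of \<open>G\<close> onto \<open>R\<close> that kills this \<open>z\<close> compares the right \<open>R\<close>-modules \<open>R\<^sup>2\<close> and \<open>M \<oplus> R\<close>.
  What is used is the resulting \<open>2 \<times> 2\<close> matrix, with columns the images of \<open>x\<close> and \<open>y\<close>, and that its
  columns span \<open>M \<oplus> R\<close> (\<open>syzygy_M\<close>, \<open>syzygy_z\<close>). The map to \<open>M \<oplus> R\<close> comes from the universal
  property of the free product with triangular matrices as target (\<open>free_factor_ex\<close>).

  First, reducing the matrix modulo augmentations shows that \<open>M\<close> is spanned by one element modulo \<open>M\<^sup>2\<close>
  (\<open>span_line\<close>). Hence a bound on the order of all commutators of \<open>R\<close> always improves by one, and
  since no nonzero element of \<open>G\<close> has infinite order, \<open>R\<close> is commutative (\<open>commutative\<close>).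

  Now determinants make sense, and Cramer's rule shows that the determinant \<open>s\<close> of the matrix generates
  the ideal \<open>M\<close> (\<open>M_principal\<close>). Finally each \<open>r\<close> in \<open>R\<close> is \<open>\<epsilon> r + s r'\<close>, and \<open>r'\<close> has smaller degree
  than \<open>r\<close> in \<open>G\<close> because degrees in a free algebra over a field are additive. By induction
  \<open>R = K[s]\<close>, and \<open>s\<close> is transcendental as soon as it is nonzero (\<open>polynomial_algebra\<close>). If \<open>s\<close>
  were zero, \<open>R\<close> would be \<open>K\<close> and the free product would be the commutative algebra \<open>K[z]\<close>, whereas
  \<open>x y \<noteq> y x\<close> (\<open>free_product_trivial_comm\<close>).
\<close>

section \<open>Words and coefficients in a free algebra\<close>

context free_alg
begin

sublocale FA: assoc_algebra K F
  by (rule assoc_algebra)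

lemma letter_mult_apply:
  assumes g: "g \<in> carrier F"
  shows "(word K [x] \<otimes>\<^bsub>F\<^esub> g) w = (case w of [] \<Rightarrow> \<zero> | a # v \<Rightarrow> if a = x then g v else \<zero>)"
proof (cases w)
  case Nil
  then show ?thesis using closed[OF g] by (simp add: ops word_def)
next
  case (Cons a v)
  have "(word K [x] \<otimes>\<^bsub>F\<^esub> g) w
      = (\<Oplus>i\<in>{..length w}. if 1 = i then (if a = x then g v else \<zero>) else \<zero>)"
    unfolding ops
  proof (rule K.finsum_cong'[OF refl])
    fix i assume "i \<in> {..length w}"
    then show "word K [x] (take i w) \<otimes> g (drop i w) = (if 1 = i then if a = x then g v else \<zero> else \<zero>)"
      using closed[OF g] by (cases i; cases v) (auto simp: word_def Cons take_Cons' split: if_splits)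
  qed (use closed[OF g] in auto)
  also have "\<dots> = (if a = x then g v else \<zero>)"
    using closed[OF g] by (intro K.finsum_singleton) (auto simp: Cons)
  finally show ?thesis by (simp add: Cons)
qed

definition shift :: "'x \<Rightarrow> ('x list \<Rightarrow> 'a) \<Rightarrow> 'x list \<Rightarrow> 'a"
  where "shift x f = (\<lambda>w. f (x # w))"

lemma shift_closed:
  assumes f: "f \<in> carrier F"
  shows "shift x f \<in> carrier F"
proof (rule carrierI[where S = "(\<lambda>w. x # w) -` {w. f w \<noteq> \<zero>}"])
  show "finite ((\<lambda>w. x # w) -` {w. f w \<noteq> \<zero>})"
    by (rule finite_vimageI[OF support(1)[OF f]]) (simp add: inj_def)
  show "shift x f w \<in> carrier K" for w using closed[OF f] by (simp add: shift_def)
  show "w \<in> (\<lambda>w. x # w) -` {w. f w \<noteq> \<zero>} \<and> set w \<subseteq> X" if "shift x f w \<noteq> \<zero>" for w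
    using support(2)[OF f, of "x # w"] that by (auto simp: shift_def)
qed

lemma one_apply: "(c \<odot>\<^bsub>F\<^esub> \<one>\<^bsub>F\<^esub>) w = c \<otimes> (if w = [] then \<one> else \<zero>)"
  by (simp add: ops)

lemma mult_apply_Nil:
  assumes "f \<in> carrier F" "g \<in> carrier F"
  shows "(f \<otimes>\<^bsub>F\<^esub> g) [] = f [] \<otimes> g []"
  using closed[OF assms(1)] closed[OF assms(2)] by (simp add: ops)

lemma mult_apply_singleton:
  assumes f: "f \<in> carrier F" and g: "g \<in> carrier F"
    and z: "\<And>i. i \<le> length w \<Longrightarrow> i \<noteq> k \<Longrightarrow> f (take i w) = \<zero> \<or> g (drop i w) = \<zero>" and k: "k \<le> length w"
  shows "(f \<otimes>\<^bsub>F\<^esub> g) w = f (take k w) \<otimes> g (drop k w)"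
proof -
  have "(f \<otimes>\<^bsub>F\<^esub> g) w = (\<Oplus>i\<in>{..length w}. if k = i then f (take k w) \<otimes> g (drop k w) else \<zero>)"
    unfolding ops
  proof (rule K.finsum_cong'[OF refl])
    fix i assume "i \<in> {..length w}"
    then show "f (take i w) \<otimes> g (drop i w) = (if k = i then f (take k w) \<otimes> g (drop k w) else \<zero>)"
      using z[of i] closed[OF f] closed[OF g] by auto
  qed (use closed[OF f] closed[OF g] in auto)
  also have "\<dots> = f (take k w) \<otimes> g (drop k w)"
    using closed[OF f] closed[OF g] k by (intro K.finsum_singleton) auto
  finally show ?thesis .
qed

text \<open>The product of two polynomials is read off at the concatenation of two longest words: any other
  cut of \<open>u @ v\<close> leaves a factor that is too long. Over a domain this makes degrees additive
  although no order is chosen on the words of one length.\<close>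

lemma mult_apply_top:
  assumes f: "f \<in> carrier F" and g: "g \<in> carrier F"
    and u: "\<And>w. length u < length w \<Longrightarrow> f w = \<zero>" and v: "\<And>w. length v < length w \<Longrightarrow> g w = \<zero>"
  shows "(f \<otimes>\<^bsub>F\<^esub> g) (u @ v) = f u \<otimes> g v"
proof -
  have "(f \<otimes>\<^bsub>F\<^esub> g) (u @ v) = f (take (length u) (u @ v)) \<otimes> g (drop (length u) (u @ v))"
  proof (rule mult_apply_singleton[OF f g])
    fix i assume i: "i \<le> length (u @ v)" "i \<noteq> length u"
    then consider "length u < i" | "i < length u" by linarith
    then show "f (take i (u @ v)) = \<zero> \<or> g (drop i (u @ v)) = \<zero>"
    proof cases
      case 1
      then show ?thesis using i by (intro disjI1 u) simp
    next
      case 2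
      then show ?thesis using i by (intro disjI2 v) simp
    qed
  qed simp
  then show ?thesis by simp
qed

lemma longest_word:
  assumes f: "f \<in> carrier F" and nz: "f w \<noteq> \<zero>"
  obtains u where "f u \<noteq> \<zero>" "length w \<le> length u" "\<And>v. length u < length v \<Longrightarrow> f v = \<zero>"
proof -
  define M where "M = Max (length ` {w. f w \<noteq> \<zero>})"
  have fin: "finite (length ` {w. f w \<noteq> \<zero>})" using support(1)[OF f] by simp
  have "M \<in> length ` {w. f w \<noteq> \<zero>}"
    unfolding M_def using fin nz by (intro Max_in) auto
  then obtain u where u: "f u \<noteq> \<zero>" "length u = M" by auto
  have le: "length v \<le> M" if "f v \<noteq> \<zero>" for v
    unfolding M_def using that by (intro Max_ge[OF fin]) auto
  show thesis using le u that[of u] nz by (metis leD)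
qed

text \<open>This is the \<open>n\<close>-th power of the ideal generated by the variables. These powers intersect
  in zero, which turns congruences of arbitrarily high order into equations.\<close>

definition order_ge :: "nat \<Rightarrow> ('x list \<Rightarrow> 'a) set"
  where "order_ge n = {f \<in> carrier F. \<forall>w. length w < n \<longrightarrow> f w = \<zero>}"

lemma order_ge_add: "f \<in> order_ge n \<Longrightarrow> g \<in> order_ge n \<Longrightarrow> f \<oplus>\<^bsub>F\<^esub> g \<in> order_ge n"
  by (auto simp: order_ge_def add_closed) (simp add: ops)

lemma order_ge_smult: "a \<in> carrier K \<Longrightarrow> f \<in> order_ge n \<Longrightarrow> a \<odot>\<^bsub>F\<^esub> f \<in> order_ge n"
  by (auto simp: order_ge_def smult_closed) (simp add: ops)

lemma order_ge_mult:
  assumes f: "f \<in> order_ge m" and g: "g \<in> order_ge n"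
  shows "f \<otimes>\<^bsub>F\<^esub> g \<in> order_ge (m + n)"
proof -
  have fc: "f \<in> carrier F" and gc: "g \<in> carrier F"
    using f g by (auto simp: order_ge_def)
  have "(f \<otimes>\<^bsub>F\<^esub> g) w = \<zero>" if w: "length w < m + n" for w
    unfolding ops
  proof (intro K.add.finprod_one_eqI)
    fix i assume "i \<in> {..length w}"
    then have "length (take i w) < m \<or> length (drop i w) < n" using w by auto
    then have "f (take i w) = \<zero> \<or> g (drop i w) = \<zero>"
      using f g unfolding order_ge_def by blast
    then show "f (take i w) \<otimes> g (drop i w) = \<zero>"
      using closed[OF fc] closed[OF gc] by auto
  qed
  then show ?thesis using fc gc by (auto simp: order_ge_def mult_closed)
qed

lemma order_ge_all: "(\<And>n. f \<in> order_ge n) \<Longrightarrow> f = \<zero>\<^bsub>F\<^esub>"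
  by (auto simp: order_ge_def ops)

end

text \<open>The words are sorted by their first letter. Thus the variables generate the ideal of polynomials
  without constant term already as a right ideal.\<close>

lemma free_algebra_decompose_unit:
  fixes K (structure) and F
  defines F: "F \<equiv> free_algebra K (UNIV :: unit set)"
  assumes "cring K" and f: "f \<in> carrier F"
  shows "f = f [] \<odot>\<^bsub>F\<^esub> \<one>\<^bsub>F\<^esub> \<oplus>\<^bsub>F\<^esub> word K [()] \<otimes>\<^bsub>F\<^esub> (\<lambda>w. f (() # w))"
proof -
  interpret K: cring K by fact
  interpret free_alg K "UNIV :: unit set" F by unfold_locales (simp add: F)
  note [simp] = closed[OF f] and cl = shift_closed[OF f, unfolded shift_def]
  show ?thesis
  proof
    fix w show "f w = (f [] \<odot>\<^bsub>F\<^esub> \<one>\<^bsub>F\<^esub> \<oplus>\<^bsub>F\<^esub> word K [()] \<otimes>\<^bsub>F\<^esub> (\<lambda>w. f (() # w))) w"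
      by (simp add: ops(1) one_apply letter_mult_apply cl split: list.split)
  qed
qed

lemma free_algebra_decompose_bool:
  fixes K (structure) and F
  defines F: "F \<equiv> free_algebra K (UNIV :: bool set)"
  assumes "cring K" and f: "f \<in> carrier F"
  shows "f = f [] \<odot>\<^bsub>F\<^esub> \<one>\<^bsub>F\<^esub> \<oplus>\<^bsub>F\<^esub> (word K [True] \<otimes>\<^bsub>F\<^esub> (\<lambda>w. f (True # w))
     \<oplus>\<^bsub>F\<^esub> word K [False] \<otimes>\<^bsub>F\<^esub> (\<lambda>w. f (False # w)))"
proof -
  interpret K: cring K by fact
  interpret free_alg K "UNIV :: bool set" F by unfold_locales (simp add: F)
  note [simp] = closed[OF f] and cl = shift_closed[OF f, unfolded shift_def]
  show ?thesis
  proof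
    fix w show "f w = (f [] \<odot>\<^bsub>F\<^esub> \<one>\<^bsub>F\<^esub> \<oplus>\<^bsub>F\<^esub> (word K [True] \<otimes>\<^bsub>F\<^esub> (\<lambda>w. f (True # w))
     \<oplus>\<^bsub>F\<^esub> word K [False] \<otimes>\<^bsub>F\<^esub> (\<lambda>w. f (False # w)))) w"
      by (auto simp add: ops(1) one_apply letter_mult_apply cl split: list.split)
  qed
qed

section \<open>Inverses of isomorphisms\<close>

lemma alg_hom_inverse:
  assumes A: "assoc_algebra K A" and h: "h \<in> alg_hom K A B" and b: "bij_betw h (carrier A) (carrier B)"
  shows "inv_into (carrier A) h \<in> alg_hom K B A"
proof -
  interpret A: assoc_algebra K A by fact
  note H = alg_homD[OF h]
  define g where "g = inv_into (carrier A) h"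
  have inj: "inj_on h (carrier A)" and img: "h ` carrier A = carrier B"
    using b by (auto simp: bij_betw_def)
  have gc: "g y \<in> carrier A" and hg: "h (g y) = y" if "y \<in> carrier B" for y
    using that img by (auto simp: g_def inv_into_into f_inv_into_f)
  have eq: "g y = x" if "x \<in> carrier A" "h x = y" for x y
    using that inj by (auto simp: g_def)
  have "g \<in> alg_hom K B A"
    by (rule alg_homI) (auto simp: gc hg H intro!: eq)
  then show ?thesis by (simp add: g_def)
qed

lemma alg_isomorphic_sym:
  "assoc_algebra K A \<Longrightarrow> alg_isomorphic K A B \<Longrightarrow> alg_isomorphic K B A"
  unfolding alg_isomorphic_def using alg_hom_inverse bij_betw_inv_into by blast

lemma alg_isomorphic_trans:
  "alg_isomorphic K A B \<Longrightarrow> alg_isomorphic K B C \<Longrightarrow> alg_isomorphic K A C"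
  unfolding alg_isomorphic_def
  using alg_hom_compose bij_betw_trans[unfolded comp_def] by fast

section \<open>The free algebra of rank one\<close>

text \<open>Words over a one-letter alphabet are determined by their length, which identifies them with
  exponents. Through this isomorphism \<^term>\<open>UP K\<close> receives the universal property for
  noncommutative target algebras, where evaluation of polynomials with central scalars still makes
  sense.\<close>

definition UP_to_free :: "(nat \<Rightarrow> 'k) \<Rightarrow> unit list \<Rightarrow> 'k"
  where "UP_to_free f = (\<lambda>w. f (length w))"

lemma unit_list_eq_iff: "(v :: unit list) = w \<longleftrightarrow> length v = length w"
  by (auto intro: nth_equalityI)

lemma UP_to_free_iso:
  assumes K: "cring K"
  shows "UP_to_free \<in> alg_hom K (UP K) (free_algebra K (UNIV :: unit set))" (is "_ \<in> alg_hom K _ ?F")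
    and "bij_betw UP_to_free (carrier (UP K)) (carrier (free_algebra K (UNIV :: unit set)))"
proof -
  interpret K: cring K by fact
  interpret free_alg K "UNIV :: unit set" ?F by unfold_locales simp
  have fin: "finite {w :: unit list. length w \<le> n}" for n
    using finite_lists_length_le[of "UNIV :: unit set" n] by simp
  have cl: "UP_to_free f \<in> carrier ?F" if f: "f \<in> carrier (UP K)" for f
  proof -
    obtain n where n: "bound \<zero>\<^bsub>K\<^esub> n f" using f by (auto simp: UP_def up_def)
    show ?thesis
    proof (rule carrierI[where S = "{w. length w \<le> n}"])
      show "w \<in> {w. length w \<le> n} \<and> set w \<subseteq> UNIV" if "UP_to_free f w \<noteq> \<zero>\<^bsub>K\<^esub>" for w
        using that n by (auto simp: UP_to_free_def bound_def not_less[symmetric])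
    qed (use f fin in \<open>auto simp: UP_def up_def UP_to_free_def\<close>)
  qed
  show "UP_to_free \<in> alg_hom K (UP K) ?F"
  proof (rule alg_homI)
    fix f g assume fg: "f \<in> carrier (UP K)" "g \<in> carrier (UP K)"
    then have fg': "f i \<in> carrier K" "g i \<in> carrier K" for i by (auto simp: UP_def up_def)
    show "UP_to_free (f \<otimes>\<^bsub>UP K\<^esub> g) = UP_to_free f \<otimes>\<^bsub>?F\<^esub> UP_to_free g"
      unfolding ops using fg fg'
      by (auto simp: UP_to_free_def UP_def min_def intro!: ext K.finsum_cong')
  next
    show "UP_to_free f \<in> carrier ?F" if "f \<in> carrier (UP K)" for f using that by (rule cl)
  qed (auto simp: ops UP_to_free_def UP_def)
  show "bij_betw UP_to_free (carrier (UP K)) (carrier ?F)"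
  proof (rule bij_betwI')
    show "UP_to_free f = UP_to_free g \<longleftrightarrow> f = g" for f g :: "nat \<Rightarrow> 'a"
    proof
      assume eq: "UP_to_free f = UP_to_free g"
      have "f n = g n" for n using fun_cong[OF eq, of "replicate n ()"] by (simp add: UP_to_free_def)
      then show "f = g" by blast
    qed simp
  next
    fix g assume g: "g \<in> carrier ?F"
    define f where "f n = g (replicate n ())" for n
    have rep: "replicate (length w) () = w" for w by (simp add: unit_list_eq_iff)
    have "finite (length ` {w. g w \<noteq> \<zero>\<^bsub>K\<^esub>})" using support(1)[OF g] by simp
    then obtain n where n: "\<And>w. g w \<noteq> \<zero>\<^bsub>K\<^esub> \<Longrightarrow> length w \<le> n"
      by (auto simp: finite_nat_set_iff_bounded_le)
    have "bound \<zero>\<^bsub>K\<^esub> n f"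
      using n[of "replicate _ ()"] by (force simp: bound_def f_def)
    then have "f \<in> carrier (UP K)"
      using closed[OF g] by (auto simp: UP_def up_def f_def)
    moreover have "g = UP_to_free f"
      by (simp add: UP_to_free_def f_def rep)
    ultimately show "\<exists>f\<in>carrier (UP K). g = UP_to_free f" by blast
  qed (rule cl)
qed

abbreviation UP_var :: "('k, 'l) ring_scheme \<Rightarrow> nat \<Rightarrow> 'k"
  where "UP_var K \<equiv> monom (UP K) \<one>\<^bsub>K\<^esub> (Suc 0)"

lemma UP_to_free_var:
  assumes "cring K"
  shows "UP_to_free (UP_var K) = word K [()]"
proof -
  interpret K: cring K by fact
  show ?thesis by (auto simp: UP_to_free_def UP_def word_def unit_list_eq_iff)
qed

lemma UP_var_closed: "cring K \<Longrightarrow> UP_var K \<in> carrier (UP K)"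
proof -
  assume "cring K"
  then interpret UP_cring K "UP K" by (simp_all add: UP_cring_def)
  show ?thesis by simp
qed

lemma UP_hom_ex:
  assumes C: "assoc_algebra K C" and c: "c \<in> carrier C"
  shows "\<exists>h\<in>alg_hom K (UP K) C. h (UP_var K) = c"
proof -
  interpret C: assoc_algebra K C by fact
  have K: "cring K" by (rule C.V.R.is_cring)
  obtain g where g: "g \<in> alg_hom K (free_algebra K (UNIV :: unit set)) C" "g (word K [()]) = c"
    using free_algebra_universal[OF C, of "UNIV :: unit set" "\<lambda>_. c"] c by auto
  show ?thesis
    by (rule bexI[OF _ alg_hom_compose[OF UP_to_free_iso(1)[OF K] g(1)]])
      (simp add: UP_to_free_var[OF K] g(2))
qed

lemma UP_hom_unique:
  assumes C: "assoc_algebra K C" and g: "g \<in> alg_hom K (UP K) C" and h: "h \<in> alg_hom K (UP K) C"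
    and eq: "g (UP_var K) = h (UP_var K)" and f: "f \<in> carrier (UP K)"
  shows "g f = h f"
proof -
  interpret C: assoc_algebra K C by fact
  have K: "cring K" by (rule C.V.R.is_cring)
  define J where "J = inv_into (carrier (UP K)) UP_to_free"
  note bij = UP_to_free_iso(2)[OF K]
  have J: "J \<in> alg_hom K (free_algebra K (UNIV :: unit set)) (UP K)"
    unfolding J_def by (rule alg_hom_inverse[OF UP_assoc_algebra[OF K] UP_to_free_iso(1)[OF K] bij])
  have inv: "J (UP_to_free p) = p" if "p \<in> carrier (UP K)" for p
    unfolding J_def by (rule inv_into_f_f[OF bij_betw_imp_inj_on[OF bij] that])
  have "g (J (word K [x])) = h (J (word K [x]))" for x
    using inv[OF UP_var_closed[OF K]] eq by (simp add: UP_to_free_var[OF K])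
  then have "g (J (UP_to_free f)) = h (J (UP_to_free f))"
    by (rule free_algebra_hom_unique[OF C alg_hom_compose[OF J g] alg_hom_compose[OF J h]])
      (rule alg_homD(1)[OF UP_to_free_iso(1)[OF K] f])
  then show ?thesis by (simp add: inv f)
qed

section \<open>Triangular matrices\<close>

text \<open>The triple \<open>(a, b, c)\<close> stands for the upper triangular matrix with diagonal \<open>a\<close>, \<open>c\<close> and
  corner \<open>b\<close>. A homomorphism \<open>f \<mapsto> (e f, d f, p f)\<close> into it is a pair of homomorphisms \<open>e\<close>, \<open>p\<close>
  together with an \<open>(e, p)\<close>-derivation \<open>d\<close>, so that the universal property of a free product also
  constructs derivations.\<close>

definition triangular :: "('k, 'a, 'm) module_scheme \<Rightarrow> ('k, 'a \<times> 'a \<times> 'a) module"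
  where "triangular A = \<lparr>
    carrier = carrier A \<times> carrier A \<times> carrier A,
    mult = (\<lambda>(a, b, c) (a', b', c'). (a \<otimes>\<^bsub>A\<^esub> a', a \<otimes>\<^bsub>A\<^esub> b' \<oplus>\<^bsub>A\<^esub> b \<otimes>\<^bsub>A\<^esub> c', c \<otimes>\<^bsub>A\<^esub> c')),
    one = (\<one>\<^bsub>A\<^esub>, \<zero>\<^bsub>A\<^esub>, \<one>\<^bsub>A\<^esub>),
    zero = (\<zero>\<^bsub>A\<^esub>, \<zero>\<^bsub>A\<^esub>, \<zero>\<^bsub>A\<^esub>),
    add = (\<lambda>(a, b, c) (a', b', c'). (a \<oplus>\<^bsub>A\<^esub> a', b \<oplus>\<^bsub>A\<^esub> b', c \<oplus>\<^bsub>A\<^esub> c')),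
    smult = (\<lambda>k (a, b, c). (k \<odot>\<^bsub>A\<^esub> a, k \<odot>\<^bsub>A\<^esub> b, k \<odot>\<^bsub>A\<^esub> c))\<rparr>"

lemma triangular_simps:
  "(a, b, c) \<in> carrier (triangular A) \<longleftrightarrow> a \<in> carrier A \<and> b \<in> carrier A \<and> c \<in> carrier A"
  "(a, b, c) \<otimes>\<^bsub>triangular A\<^esub> (a', b', c')
    = (a \<otimes>\<^bsub>A\<^esub> a', a \<otimes>\<^bsub>A\<^esub> b' \<oplus>\<^bsub>A\<^esub> b \<otimes>\<^bsub>A\<^esub> c', c \<otimes>\<^bsub>A\<^esub> c')"
  "\<one>\<^bsub>triangular A\<^esub> = (\<one>\<^bsub>A\<^esub>, \<zero>\<^bsub>A\<^esub>, \<one>\<^bsub>A\<^esub>)"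
  "\<zero>\<^bsub>triangular A\<^esub> = (\<zero>\<^bsub>A\<^esub>, \<zero>\<^bsub>A\<^esub>, \<zero>\<^bsub>A\<^esub>)"
  "(a, b, c) \<oplus>\<^bsub>triangular A\<^esub> (a', b', c') = (a \<oplus>\<^bsub>A\<^esub> a', b \<oplus>\<^bsub>A\<^esub> b', c \<oplus>\<^bsub>A\<^esub> c')"
  "k \<odot>\<^bsub>triangular A\<^esub> (a, b, c) = (k \<odot>\<^bsub>A\<^esub> a, k \<odot>\<^bsub>A\<^esub> b, k \<odot>\<^bsub>A\<^esub> c)"
  by (simp_all add: triangular_def)

lemma triangular_assoc_algebra:
  assumes "assoc_algebra K A"
  shows "assoc_algebra K (triangular A)"
proof -
  interpret A: assoc_algebra K A by fact
  let ?T = "triangular A"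
  note [simp] = triangular_simps
  have ag: "abelian_group ?T"
  proof (rule abelian_groupI)
    fix x assume "x \<in> carrier ?T"
    then show "\<exists>y\<in>carrier ?T. y \<oplus>\<^bsub>?T\<^esub> x = \<zero>\<^bsub>?T\<^esub>"
      by (cases x) (auto intro!: bexI[of _ "(\<ominus>\<^bsub>A\<^esub> fst x, \<ominus>\<^bsub>A\<^esub> fst (snd x), \<ominus>\<^bsub>A\<^esub> snd (snd x))"]
          simp: A.V.M.l_neg)
  qed (auto simp: A.V.M.a_ac)
  have "Group.monoid ?T"
    by (rule monoidI) (auto simp: A.A.m_assoc A.A.l_distr A.A.r_distr A.V.M.a_assoc)
  then have ring: "ring ?T"
    by (intro ringI ag) (auto simp: A.A.l_distr A.A.r_distr A.V.M.a_ac)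
  have "module K ?T"
    by (rule moduleI[OF A.V.R.is_cring ag])
      (auto simp: A.smult_l_distr A.smult_r_distr A.smult_assoc1)
  then show ?thesis
    by (intro assoc_algebra.intro assoc_algebra_axioms.intro ring)
      (auto simp: A.smult_mult_left A.smult_mult_right A.smult_r_distr)
qed

section \<open>Generation of free products\<close>

context two_algebras
begin

lemma free_product_generated:
  assumes "\<And>x. x \<in> carrier A \<Longrightarrow> free_product_inl K A B x \<in> S"
    and "\<And>y. y \<in> carrier B \<Longrightarrow> free_product_inr K A B y \<in> S"
    and mult: "\<And>p q. p \<in> S \<Longrightarrow> q \<in> S \<Longrightarrow> p \<otimes>\<^bsub>free_product K A B\<^esub> q \<in> S"
    and add: "\<And>p q. p \<in> S \<Longrightarrow> q \<in> S \<Longrightarrow> p \<oplus>\<^bsub>free_product K A B\<^esub> q \<in> S"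
    and smult: "\<And>a p. a \<in> carrier K \<Longrightarrow> p \<in> S \<Longrightarrow> a \<odot>\<^bsub>free_product K A B\<^esub> p \<in> S"
  shows "carrier (free_product K A B) \<subseteq> S"
proof
  define pr where "pr = (\<lambda>x. J +>\<^bsub>F\<^esub> x)"
  have pr: "pr \<in> alg_hom K F (free_product K A B)"
    unfolding free_product_def pr_def by (rule Q.proj_hom)
  note prD = alg_homD[OF pr]
  have letter: "pr (word K [x]) \<in> S" if "x \<in> carrier A <+> carrier B" for x
    using that assms(1,2) by (auto simp: pr_def free_product_inl_def free_product_inr_def)
  have "pr (word K []) = free_product_inl K A B \<one>\<^bsub>A\<^esub>"
    using prD(4) alg_homD(4)[OF free_product_inl_hom] by (simp add: FA.one_word)
  then have nil: "pr (word K []) \<in> S" using assms(1) by simp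
  have word: "pr (word K w) \<in> S" if "set w \<subseteq> carrier A <+> carrier B" for w
    using that
  proof (induction w)
    case (Cons x w)
    have "word K (x # w) = word K [x] \<otimes>\<^bsub>F\<^esub> word K w" by (simp add: FA.word_mult)
    then show ?case using Cons by (simp add: prD(2) FA.word_closed letter mult)
  qed (rule nil)
  have "pr f \<in> S" if "f \<in> carrier F" for f
    using that
  proof (induction f rule: FA.free_algebra_induct)
    case zero
    have "pr (\<zero> \<odot>\<^bsub>F\<^esub> word K []) \<in> S"
      using nil by (subst prD(5)) (auto intro: FA.word_closed smult)
    then show ?case by (simp add: FA.word_closed)
  next
    case (add c w f)
    then show ?case by (simp add: prD(3,5) FA.word_closed word smult assms(4))
  qed
  then show "p \<in> S" if "p \<in> carrier (free_product K A B)" for p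
    using that by (auto simp: free_product_def Q.Q_carrier pr_def)
qed

text \<open>If the first factor is spanned by the unit, the second factor already exhausts the free
  product. This excludes the degenerate case in which \<open>R\<close> is \<open>K\<close> itself.\<close>

lemma free_product_trivial_comm:
  assumes A: "carrier A = (\<lambda>a. a \<odot>\<^bsub>A\<^esub> \<one>\<^bsub>A\<^esub>) ` carrier K"
    and comm: "\<And>x y. x \<in> carrier B \<Longrightarrow> y \<in> carrier B \<Longrightarrow> x \<otimes>\<^bsub>B\<^esub> y = y \<otimes>\<^bsub>B\<^esub> x"
    and pq: "p \<in> carrier (free_product K A B)" "q \<in> carrier (free_product K A B)"
  shows "p \<otimes>\<^bsub>free_product K A B\<^esub> q = q \<otimes>\<^bsub>free_product K A B\<^esub> p"
proof -
  let ?j = "free_product_inr K A B"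
  note L = alg_homD[OF free_product_inl_hom] and R = alg_homD[OF free_product_inr_hom]
  have "carrier (free_product K A B) \<subseteq> ?j ` carrier B"
  proof (rule free_product_generated)
    fix x assume "x \<in> carrier A"
    then obtain a where "a \<in> carrier K" "x = a \<odot>\<^bsub>A\<^esub> \<one>\<^bsub>A\<^esub>" using A by blast
    then have "free_product_inl K A B x = ?j (a \<odot>\<^bsub>B\<^esub> \<one>\<^bsub>B\<^esub>)"
      by (simp add: L(4,5) R(4,5))
    then show "free_product_inl K A B x \<in> ?j ` carrier B" using \<open>a \<in> carrier K\<close> by blast
  next
    show "p \<otimes>\<^bsub>free_product K A B\<^esub> q \<in> ?j ` carrier B" if "p \<in> ?j ` carrier B" "q \<in> ?j ` carrier B" for p q
      using that by (auto simp: R(2)[symmetric])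
    show "p \<oplus>\<^bsub>free_product K A B\<^esub> q \<in> ?j ` carrier B" if "p \<in> ?j ` carrier B" "q \<in> ?j ` carrier B" for p q
      using that by (auto simp: R(3)[symmetric])
    show "a \<odot>\<^bsub>free_product K A B\<^esub> p \<in> ?j ` carrier B" if "a \<in> carrier K" "p \<in> ?j ` carrier B" for a p
      using that by (auto simp: R(5)[symmetric])
  qed auto
  then obtain x y where "x \<in> carrier B" "y \<in> carrier B" "p = ?j x" "q = ?j y" using pq by blast
  then show ?thesis by (simp add: R(2)[symmetric] comm)
qed

end

section \<open>Free factors with a polynomial complement\<close>

text \<open>The data that an isomorphism of \<open>A \<star> K[z]\<close> with \<open>G = K\<langle>x, y\<rangle>\<close> leaves on \<open>A\<close>: the inclusion
  \<open>\<iota>\<close>, a retraction \<open>\<pi>\<close> that preserves constant terms, and the derivation \<open>\<zeta>\<close> that kills \<open>A\<close>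
  and sends \<open>z\<close> to \<open>1\<close>. It is an \<open>(\<epsilon>, \<pi>)\<close>-derivation, where \<open>\<epsilon>\<close> is
  the constant term. Here \<open>z\<close> is normalized to have constant term zero. In other words, \<open>(\<pi>, \<zeta>)\<close>
  maps the augmentation ideal of \<open>G\<close> to the right module \<open>M \<oplus> A\<close> over \<open>A\<close>, where \<open>M\<close> is the
  augmentation ideal of \<open>A\<close>.\<close>

locale free_factor = K: field K + A: assoc_algebra K A for K (structure) and A (structure) +
  fixes G :: "('a, bool list \<Rightarrow> 'a) module" and \<iota> \<pi> \<zeta> z
  assumes G_eq: "G = free_algebra K UNIV"
    and \<iota>_hom: "\<iota> \<in> alg_hom K A G" and \<pi>_hom: "\<pi> \<in> alg_hom K G A"
    and \<pi>_\<iota>: "r \<in> carrier A \<Longrightarrow> \<pi> (\<iota> r) = r"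
    and \<iota>_\<pi>_Nil: "f \<in> carrier G \<Longrightarrow> \<iota> (\<pi> f) [] = f []"
    and \<zeta>_closed: "f \<in> carrier G \<Longrightarrow> \<zeta> f \<in> carrier A"
    and \<zeta>_add: "f \<in> carrier G \<Longrightarrow> g \<in> carrier G \<Longrightarrow> \<zeta> (f \<oplus>\<^bsub>G\<^esub> g) = \<zeta> f \<oplus>\<^bsub>A\<^esub> \<zeta> g"
    and \<zeta>_mult: "f \<in> carrier G \<Longrightarrow> g \<in> carrier G
      \<Longrightarrow> \<zeta> (f \<otimes>\<^bsub>G\<^esub> g) = f [] \<odot>\<^bsub>A\<^esub> \<zeta> g \<oplus>\<^bsub>A\<^esub> \<zeta> f \<otimes>\<^bsub>A\<^esub> \<pi> g"
    and \<zeta>_\<iota>: "r \<in> carrier A \<Longrightarrow> \<zeta> (\<iota> r) = \<zero>\<^bsub>A\<^esub>"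
    and z: "z \<in> carrier G" "z [] = \<zero>" "\<pi> z = \<zero>\<^bsub>A\<^esub>" "\<zeta> z = \<one>\<^bsub>A\<^esub>"
    and nontrivial: "\<exists>r\<in>carrier A. \<forall>a\<in>carrier K. r \<noteq> a \<odot>\<^bsub>A\<^esub> \<one>\<^bsub>A\<^esub>"
begin

sublocale free_alg K "UNIV :: bool set" G
  by unfold_locales (simp add: G_eq)

lemmas \<iota>D = alg_homD[OF \<iota>_hom]
lemmas \<pi>D = alg_homD[OF \<pi>_hom]

abbreviation "x \<equiv> word K [True]"
abbreviation "y \<equiv> word K [False]"

lemma xy_closed: "x \<in> carrier G" "y \<in> carrier G"
  by (simp_all add: word_closed)

section \<open>Augmentation of a free factor\<close>

definition aug :: "'c \<Rightarrow> 'a"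
  where "aug r = \<iota> r []"

lemma aug_closed [simp]: "r \<in> carrier A \<Longrightarrow> aug r \<in> carrier K"
  by (simp add: aug_def \<iota>D(1) closed)

lemma aug_simps [simp]:
  "r \<in> carrier A \<Longrightarrow> s \<in> carrier A \<Longrightarrow> aug (r \<oplus>\<^bsub>A\<^esub> s) = aug r \<oplus> aug s"
  "r \<in> carrier A \<Longrightarrow> s \<in> carrier A \<Longrightarrow> aug (r \<otimes>\<^bsub>A\<^esub> s) = aug r \<otimes> aug s"
  "a \<in> carrier K \<Longrightarrow> r \<in> carrier A \<Longrightarrow> aug (a \<odot>\<^bsub>A\<^esub> r) = a \<otimes> aug r"
  "aug \<one>\<^bsub>A\<^esub> = \<one>" "aug \<zero>\<^bsub>A\<^esub> = \<zero>"
proof -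
  show "r \<in> carrier A \<Longrightarrow> s \<in> carrier A \<Longrightarrow> aug (r \<oplus>\<^bsub>A\<^esub> s) = aug r \<oplus> aug s"
    by (simp add: aug_def \<iota>D) (simp add: ops)
  show "r \<in> carrier A \<Longrightarrow> s \<in> carrier A \<Longrightarrow> aug (r \<otimes>\<^bsub>A\<^esub> s) = aug r \<otimes> aug s"
    by (simp add: aug_def \<iota>D mult_apply_Nil)
  show sm: "a \<in> carrier K \<Longrightarrow> r \<in> carrier A \<Longrightarrow> aug (a \<odot>\<^bsub>A\<^esub> r) = a \<otimes> aug r" for a r
    by (simp add: aug_def \<iota>D) (simp add: ops)
  show "aug \<one>\<^bsub>A\<^esub> = \<one>" by (simp add: aug_def \<iota>D) (simp add: ops)
  show "aug \<zero>\<^bsub>A\<^esub> = \<zero>" using sm[of \<zero> "\<one>\<^bsub>A\<^esub>"] by simp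
qed

definition M :: "'c set"
  where "M = {r \<in> carrier A. aug r = \<zero>}"

lemma M_closed: "r \<in> M \<Longrightarrow> r \<in> carrier A"
  by (simp add: M_def)

lemma aug_split:
  assumes r: "r \<in> carrier A"
  obtains r' where "r' \<in> M" "r = aug r \<odot>\<^bsub>A\<^esub> \<one>\<^bsub>A\<^esub> \<oplus>\<^bsub>A\<^esub> r'"
proof
  let ?c = "aug r \<odot>\<^bsub>A\<^esub> \<one>\<^bsub>A\<^esub>"
  let ?r' = "(\<ominus> \<one>) \<odot>\<^bsub>A\<^esub> ?c \<oplus>\<^bsub>A\<^esub> r"
  show "?r' \<in> M" using r by (simp add: M_def K.l_minus K.l_neg)
  show "r = ?c \<oplus>\<^bsub>A\<^esub> ?r'"
    using r by (simp add: A.smult_l_minus A.V.M.a_assoc[symmetric] A.V.M.r_neg)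
qed

section \<open>Syzygies of the images of the variables\<close>

definition "p = \<pi> x"
definition "q = \<pi> y"
definition "\<alpha> = \<zeta> x"
definition "\<beta> = \<zeta> y"

lemma coeffs_closed [simp]: "p \<in> carrier A" "q \<in> carrier A" "\<alpha> \<in> carrier A" "\<beta> \<in> carrier A"
  by (simp_all add: p_def q_def \<alpha>_def \<beta>_def \<pi>D \<zeta>_closed xy_closed)

lemma pq_M: "p \<in> M" "q \<in> M"
  using \<iota>_\<pi>_Nil[OF xy_closed(1)] \<iota>_\<pi>_Nil[OF xy_closed(2)]
  by (simp_all add: M_def) (simp_all add: aug_def p_def q_def word_def)

text \<open>The columns \<open>(p, \<alpha>)\<close> and \<open>(q, \<beta>)\<close> are the images of the free generators \<open>x\<close> and \<open>y\<close> of
  the augmentation ideal of \<open>G\<close> under \<open>(\<pi>, \<zeta>)\<close>. Since this map is right linear over \<open>\<pi>\<close>, the images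
  of all its elements are combinations of the two columns.\<close>

lemma syzygy:
  assumes f: "f \<in> carrier G" and f0: "f [] = \<zero>"
  obtains u v where "u \<in> carrier A" "v \<in> carrier A"
    "\<pi> f = p \<otimes>\<^bsub>A\<^esub> u \<oplus>\<^bsub>A\<^esub> q \<otimes>\<^bsub>A\<^esub> v" "\<zeta> f = \<alpha> \<otimes>\<^bsub>A\<^esub> u \<oplus>\<^bsub>A\<^esub> \<beta> \<otimes>\<^bsub>A\<^esub> v"
proof -
  define g h where "g = shift True f" and "h = shift False f"
  have gh: "g \<in> carrier G" "h \<in> carrier G" using f by (simp_all add: g_def h_def shift_closed)
  have "f = f [] \<odot>\<^bsub>G\<^esub> \<one>\<^bsub>G\<^esub> \<oplus>\<^bsub>G\<^esub> (x \<otimes>\<^bsub>G\<^esub> g \<oplus>\<^bsub>G\<^esub> y \<otimes>\<^bsub>G\<^esub> h)"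
    unfolding g_def h_def shift_def G_eq
    by (rule free_algebra_decompose_bool[OF K.is_cring f[unfolded G_eq]])
  then have fe: "f = x \<otimes>\<^bsub>G\<^esub> g \<oplus>\<^bsub>G\<^esub> y \<otimes>\<^bsub>G\<^esub> h"
    using gh by (simp add: f0 mult_closed xy_closed add_closed)
  have nil: "x [] = \<zero>" "y [] = \<zero>" by (simp_all add: word_def)
  have "\<pi> f = p \<otimes>\<^bsub>A\<^esub> \<pi> g \<oplus>\<^bsub>A\<^esub> q \<otimes>\<^bsub>A\<^esub> \<pi> h"
    using gh by (subst fe) (simp add: \<pi>D xy_closed mult_closed p_def q_def)
  moreover have "\<zeta> f = \<alpha> \<otimes>\<^bsub>A\<^esub> \<pi> g \<oplus>\<^bsub>A\<^esub> \<beta> \<otimes>\<^bsub>A\<^esub> \<pi> h"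
    using gh by (subst fe)
      (simp add: \<zeta>_add \<zeta>_mult \<pi>D xy_closed mult_closed \<zeta>_closed nil \<alpha>_def \<beta>_def)
  ultimately show thesis using that gh \<pi>D(1) by blast
qed

text \<open>Elements of \<open>M\<close> have the image \<open>(r, 0)\<close>, and \<open>z\<close> has the image \<open>(0, 1)\<close>. These two
  consequences say that the matrix with rows \<open>(p, q)\<close> and \<open>(\<alpha>, \<beta>)\<close> maps onto \<open>M \<oplus> A\<close>.\<close>

lemma syzygy_M:
  assumes r: "r \<in> M"
  obtains u v where "u \<in> carrier A" "v \<in> carrier A"
    "r = p \<otimes>\<^bsub>A\<^esub> u \<oplus>\<^bsub>A\<^esub> q \<otimes>\<^bsub>A\<^esub> v" "\<alpha> \<otimes>\<^bsub>A\<^esub> u \<oplus>\<^bsub>A\<^esub> \<beta> \<otimes>\<^bsub>A\<^esub> v = \<zero>\<^bsub>A\<^esub>"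
  using r syzygy[of "\<iota> r"] by (metis (mono_tags, lifting) M_def aug_def \<iota>D(1) \<pi>_\<iota> \<zeta>_\<iota> mem_Collect_eq)

lemma syzygy_z:
  obtains c d where "c \<in> carrier A" "d \<in> carrier A"
    "p \<otimes>\<^bsub>A\<^esub> c \<oplus>\<^bsub>A\<^esub> q \<otimes>\<^bsub>A\<^esub> d = \<zero>\<^bsub>A\<^esub>" "\<alpha> \<otimes>\<^bsub>A\<^esub> c \<oplus>\<^bsub>A\<^esub> \<beta> \<otimes>\<^bsub>A\<^esub> d = \<one>\<^bsub>A\<^esub>"
  using syzygy[OF z(1,2)] z(3,4) by metis

section \<open>Commutativity of a free factor\<close>

text \<open>The order of vanishing in \<open>G\<close> filters \<open>A\<close> by ideals, multiplicatively and with intersection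
  zero. It measures how far \<open>A\<close> is known to be commutative.\<close>

definition N :: "nat \<Rightarrow> 'c set"
  where "N n = {r \<in> carrier A. \<iota> r \<in> order_ge n}"

lemma N_closed: "r \<in> N n \<Longrightarrow> r \<in> carrier A"
  by (simp add: N_def)

lemma N_add: "r \<in> N n \<Longrightarrow> s \<in> N n \<Longrightarrow> r \<oplus>\<^bsub>A\<^esub> s \<in> N n"
  by (simp add: N_def \<iota>D order_ge_add)

lemma N_smult: "a \<in> carrier K \<Longrightarrow> r \<in> N n \<Longrightarrow> a \<odot>\<^bsub>A\<^esub> r \<in> N n"
  by (simp add: N_def \<iota>D order_ge_smult)

lemma N_mult: "r \<in> N m \<Longrightarrow> s \<in> N n \<Longrightarrow> r \<otimes>\<^bsub>A\<^esub> s \<in> N (m + n)"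
  by (simp add: N_def \<iota>D order_ge_mult)

lemma M_N: "M = N 1"
  by (auto simp: M_def N_def aug_def order_ge_def \<iota>D)

lemma \<iota>_zero: "\<iota> \<zero>\<^bsub>A\<^esub> = \<zero>\<^bsub>G\<^esub>"
  using \<iota>D(5)[of \<zero> "\<one>\<^bsub>A\<^esub>"] by (simp add: \<iota>D)

lemma \<iota>_zero_iff: "r \<in> carrier A \<Longrightarrow> \<iota> r = \<zero>\<^bsub>G\<^esub> \<longleftrightarrow> r = \<zero>\<^bsub>A\<^esub>"
  using \<pi>_\<iota>[of r] \<pi>_\<iota>[of "\<zero>\<^bsub>A\<^esub>"] \<iota>_zero by auto

lemma N_all: "(\<And>n. r \<in> N n) \<Longrightarrow> r = \<zero>\<^bsub>A\<^esub>"
  using order_ge_all[of "\<iota> r"] \<iota>_zero_iff[of r] by (simp add: N_def)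

definition commutator :: "'c \<Rightarrow> 'c \<Rightarrow> 'c"
  where "commutator a b = a \<otimes>\<^bsub>A\<^esub> b \<ominus>\<^bsub>A\<^esub> b \<otimes>\<^bsub>A\<^esub> a"

lemma commutator_rules:
  shows "a \<in> carrier A \<Longrightarrow> b \<in> carrier A \<Longrightarrow> c \<in> carrier A \<Longrightarrow> commutator (a \<oplus>\<^bsub>A\<^esub> b) c = commutator a c \<oplus>\<^bsub>A\<^esub> commutator b c"
    "k \<in> carrier K \<Longrightarrow> a \<in> carrier A \<Longrightarrow> b \<in> carrier A \<Longrightarrow> commutator (k \<odot>\<^bsub>A\<^esub> a) b = k \<odot>\<^bsub>A\<^esub> commutator a b"
    "a \<in> carrier A \<Longrightarrow> b \<in> carrier A \<Longrightarrow> c \<in> carrier A \<Longrightarrow> commutator (a \<otimes>\<^bsub>A\<^esub> b) c = a \<otimes>\<^bsub>A\<^esub> commutator b c \<oplus>\<^bsub>A\<^esub> commutator a c \<otimes>\<^bsub>A\<^esub> b"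
    "a \<in> carrier A \<Longrightarrow> b \<in> carrier A \<Longrightarrow> commutator a b = (\<ominus> \<one>) \<odot>\<^bsub>A\<^esub> commutator b a"
    "a \<in> carrier A \<Longrightarrow> commutator a a = \<zero>\<^bsub>A\<^esub>"
    "a \<in> carrier A \<Longrightarrow> b \<in> carrier A \<Longrightarrow> commutator a b \<in> carrier A"
    "a \<in> carrier A \<Longrightarrow> commutator \<one>\<^bsub>A\<^esub> a = \<zero>\<^bsub>A\<^esub>"
  by (simp_all add: commutator_def A.A.ring_simprules A.smult_mult_left A.smult_mult_right A.smult_r_distr
      A.smult_r_minus A.smult_l_minus)

text \<open>Modulo \<open>M\<^sup>2\<close> a product with an element of \<open>A\<close> is multiplication by its augmentation. The
  relation \<open>w d + t c = 0\<close> with \<open>aug d \<noteq> 0\<close> therefore makes \<open>w\<close> a multiple of \<open>t\<close> modulo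
  \<open>M\<^sup>2\<close>, and \<open>A\<close> is spanned by a single \<open>t\<close> modulo any subspace \<open>S\<close> that contains \<open>1\<close> and \<open>M\<^sup>2\<close>.\<close>

lemma span_line:
  assumes S_closed: "\<And>s. s \<in> S \<Longrightarrow> s \<in> carrier A" and S_one: "\<one>\<^bsub>A\<^esub> \<in> S"
    and S_add: "\<And>r s. r \<in> S \<Longrightarrow> s \<in> S \<Longrightarrow> r \<oplus>\<^bsub>A\<^esub> s \<in> S"
    and S_smult: "\<And>k s. k \<in> carrier K \<Longrightarrow> s \<in> S \<Longrightarrow> k \<odot>\<^bsub>A\<^esub> s \<in> S"
    and S_mult: "\<And>r s. r \<in> M \<Longrightarrow> s \<in> M \<Longrightarrow> r \<otimes>\<^bsub>A\<^esub> s \<in> S"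
    and tw: "t \<in> M" "w \<in> M" and cd: "c \<in> carrier A" "d \<in> carrier A" "aug d \<noteq> \<zero>"
    and rel: "w \<otimes>\<^bsub>A\<^esub> d \<oplus>\<^bsub>A\<^esub> t \<otimes>\<^bsub>A\<^esub> c = \<zero>\<^bsub>A\<^esub>"
    and gen: "\<And>r. r \<in> M \<Longrightarrow> \<exists>u\<in>carrier A. \<exists>v\<in>carrier A. r = t \<otimes>\<^bsub>A\<^esub> u \<oplus>\<^bsub>A\<^esub> w \<otimes>\<^bsub>A\<^esub> v"
    and r: "r \<in> carrier A"
  shows "\<exists>k\<in>carrier K. \<exists>s\<in>S. r = k \<odot>\<^bsub>A\<^esub> t \<oplus>\<^bsub>A\<^esub> s"
proof -
  define D where "D = {k \<odot>\<^bsub>A\<^esub> t \<oplus>\<^bsub>A\<^esub> s | k s. k \<in> carrier K \<and> s \<in> S}"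
  have tc: "t \<in> carrier A" and wc: "w \<in> carrier A" using tw by (simp_all add: M_closed)
  have D_I: "k \<odot>\<^bsub>A\<^esub> t \<oplus>\<^bsub>A\<^esub> s \<in> D" if "k \<in> carrier K" "s \<in> S" for k s
    using that unfolding D_def by blast
  have D_closed: "e \<in> carrier A" if "e \<in> D" for e using that tc S_closed by (auto simp: D_def)
  have D_S: "s \<in> D" if "s \<in> S" for s
  proof -
    have "s = \<zero> \<odot>\<^bsub>A\<^esub> t \<oplus>\<^bsub>A\<^esub> s" using that tc by (simp add: S_closed)
    then show ?thesis using D_I[OF K.zero_closed that] by simp
  qed
  have D_E: "\<exists>k s. k \<in> carrier K \<and> s \<in> S \<and> e = k \<odot>\<^bsub>A\<^esub> t \<oplus>\<^bsub>A\<^esub> s" if "e \<in> D" for e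
    using that unfolding D_def by blast
  have D_add: "e \<oplus>\<^bsub>A\<^esub> e' \<in> D" if ee: "e \<in> D" "e' \<in> D" for e e'
  proof -
    obtain k s where e: "k \<in> carrier K" "s \<in> S" "e = k \<odot>\<^bsub>A\<^esub> t \<oplus>\<^bsub>A\<^esub> s" using D_E[OF ee(1)] by blast
    obtain k' s' where e': "k' \<in> carrier K" "s' \<in> S" "e' = k' \<odot>\<^bsub>A\<^esub> t \<oplus>\<^bsub>A\<^esub> s'" using D_E[OF ee(2)] by blast
    have "e \<oplus>\<^bsub>A\<^esub> e' = (k \<oplus> k') \<odot>\<^bsub>A\<^esub> t \<oplus>\<^bsub>A\<^esub> (s \<oplus>\<^bsub>A\<^esub> s')"
      using tc e(1,2) e'(1,2) by (simp add: e(3) e'(3) A.smult_l_distr S_closed A.V.M.a_ac)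
    then show ?thesis using e(1,2) e'(1,2) by (simp only: D_I S_add K.a_closed)
  qed
  have D_smult: "k \<odot>\<^bsub>A\<^esub> e \<in> D" if k: "k \<in> carrier K" and ed: "e \<in> D" for k e
  proof -
    obtain k' s where e: "k' \<in> carrier K" "s \<in> S" "e = k' \<odot>\<^bsub>A\<^esub> t \<oplus>\<^bsub>A\<^esub> s" using D_E[OF ed] by blast
    have "k \<odot>\<^bsub>A\<^esub> e = (k \<otimes> k') \<odot>\<^bsub>A\<^esub> t \<oplus>\<^bsub>A\<^esub> k \<odot>\<^bsub>A\<^esub> s"
      using tc k e(1,2) by (simp add: e(3) A.smult_r_distr S_closed A.smult_assoc1)
    then show ?thesis using e(1,2) k by (simp only: D_I S_smult K.m_closed)
  qed
  have zero_S: "\<zero>\<^bsub>A\<^esub> \<in> S" using S_smult[of \<zero> "\<one>\<^bsub>A\<^esub>"] S_one by simp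
  have D_t: "t \<in> D"
  proof -
    have "t = \<one> \<odot>\<^bsub>A\<^esub> t \<oplus>\<^bsub>A\<^esub> \<zero>\<^bsub>A\<^esub>" using tc by simp
    then show ?thesis using D_I[OF K.one_closed zero_S] by simp
  qed
  have linear: "\<exists>s\<in>S. e \<otimes>\<^bsub>A\<^esub> f = aug f \<odot>\<^bsub>A\<^esub> e \<oplus>\<^bsub>A\<^esub> s" if ef: "e \<in> M" "f \<in> carrier A" for e f
  proof -
    obtain f' where f': "f' \<in> M" "f = aug f \<odot>\<^bsub>A\<^esub> \<one>\<^bsub>A\<^esub> \<oplus>\<^bsub>A\<^esub> f'" using aug_split[OF ef(2)] .
    have "e \<otimes>\<^bsub>A\<^esub> f = aug f \<odot>\<^bsub>A\<^esub> e \<oplus>\<^bsub>A\<^esub> e \<otimes>\<^bsub>A\<^esub> f'"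
      using ef f'(1) by (subst f'(2)) (simp add: M_closed A.A.r_distr A.smult_mult_right)
    then show ?thesis using S_mult[OF ef(1) f'(1)] by blast
  qed
  have D_w: "w \<in> D"
  proof -
    obtain s s' where s: "s \<in> S" "w \<otimes>\<^bsub>A\<^esub> d = aug d \<odot>\<^bsub>A\<^esub> w \<oplus>\<^bsub>A\<^esub> s"
      "s' \<in> S" "t \<otimes>\<^bsub>A\<^esub> c = aug c \<odot>\<^bsub>A\<^esub> t \<oplus>\<^bsub>A\<^esub> s'"
      using linear tw cd by meson
    have "s \<oplus>\<^bsub>A\<^esub> (aug c \<odot>\<^bsub>A\<^esub> t \<oplus>\<^bsub>A\<^esub> s') \<in> D"
      using s cd by (intro D_add D_S D_smult D_t) auto
    moreover have "aug d \<odot>\<^bsub>A\<^esub> w \<oplus>\<^bsub>A\<^esub> (s \<oplus>\<^bsub>A\<^esub> (aug c \<odot>\<^bsub>A\<^esub> t \<oplus>\<^bsub>A\<^esub> s')) = \<zero>\<^bsub>A\<^esub>"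
      using rel s cd tc wc by (simp add: A.V.M.a_assoc S_closed)
    ultimately have "aug d \<odot>\<^bsub>A\<^esub> w = (\<ominus> \<one>) \<odot>\<^bsub>A\<^esub> (s \<oplus>\<^bsub>A\<^esub> (aug c \<odot>\<^bsub>A\<^esub> t \<oplus>\<^bsub>A\<^esub> s'))"
      using cd wc D_closed by (simp add: A.smult_l_minus A.V.M.minus_equality[symmetric])
    then have "aug d \<odot>\<^bsub>A\<^esub> w \<in> D"
      using \<open>s \<oplus>\<^bsub>A\<^esub> (aug c \<odot>\<^bsub>A\<^esub> t \<oplus>\<^bsub>A\<^esub> s') \<in> D\<close> by (simp only: D_smult K.a_inv_closed K.one_closed)
    moreover have "aug d \<in> Units K" using cd K.field_Units by auto
    ultimately show ?thesis
      using D_smult[of "inv aug d" "aug d \<odot>\<^bsub>A\<^esub> w"] wc cd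
      by (simp add: A.smult_assoc1[symmetric])
  qed
  have "r \<in> D" if r: "r \<in> carrier A" for r
  proof -
    obtain r' where r': "r' \<in> M" "r = aug r \<odot>\<^bsub>A\<^esub> \<one>\<^bsub>A\<^esub> \<oplus>\<^bsub>A\<^esub> r'" using aug_split[OF r] .
    obtain u v where uv: "u \<in> carrier A" "v \<in> carrier A" "r' = t \<otimes>\<^bsub>A\<^esub> u \<oplus>\<^bsub>A\<^esub> w \<otimes>\<^bsub>A\<^esub> v"
      using gen[OF r'(1)] by blast
    have "e \<otimes>\<^bsub>A\<^esub> f \<in> D" if ef: "e \<in> M" "e \<in> D" "f \<in> carrier A" for e f
    proof -
      obtain s where s: "s \<in> S" "e \<otimes>\<^bsub>A\<^esub> f = aug f \<odot>\<^bsub>A\<^esub> e \<oplus>\<^bsub>A\<^esub> s" using linear[OF ef(1,3)] by blast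
      show ?thesis unfolding s(2)
        by (rule D_add[OF D_smult[OF aug_closed[OF ef(3)] ef(2)] D_S[OF s(1)]])
    qed
    then have "r' \<in> D" using uv tw D_t D_w D_add by simp
    moreover have "aug r \<odot>\<^bsub>A\<^esub> \<one>\<^bsub>A\<^esub> \<in> D" using r by (intro D_smult D_S S_one) simp
    ultimately show ?thesis using r'(2) D_add by metis
  qed
  then show ?thesis using r unfolding D_def by blast
qed

text \<open>If all commutators have order at least \<open>n\<close>, the elements whose commutators have larger order
  form a subspace containing \<open>M\<^sup>2\<close>, by the Leibniz rule. Modulo it, \<open>A\<close> is spanned by one element, which commutes with itself.\<close>

lemma commutator_order_step:
  assumes IH: "\<And>a b. a \<in> carrier A \<Longrightarrow> b \<in> carrier A \<Longrightarrow> commutator a b \<in> N n"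
    and ab: "a \<in> carrier A" "b \<in> carrier A"
  shows "commutator a b \<in> N (Suc n)"
proof -
  define S where "S = {a \<in> carrier A. \<forall>b\<in>carrier A. commutator a b \<in> N (Suc n)}"
  have S_closed: "s \<in> carrier A" if "s \<in> S" for s using that by (simp add: S_def)
  have S_add: "s \<oplus>\<^bsub>A\<^esub> t \<in> S" if "s \<in> S" "t \<in> S" for s t
    using that by (auto simp: S_def commutator_rules(1) N_add)
  have S_smult: "k \<odot>\<^bsub>A\<^esub> s \<in> S" if "k \<in> carrier K" "s \<in> S" for k s
    using that by (auto simp: S_def commutator_rules(2) N_smult)
  have zero_N: "\<zero>\<^bsub>A\<^esub> \<in> N (Suc n)"
    by (simp add: N_def \<iota>_zero) (simp add: order_ge_def zero_closed, simp add: ops)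
  have S_one: "\<one>\<^bsub>A\<^esub> \<in> S" by (auto simp: S_def commutator_rules(7) zero_N)
  have S_mult: "r \<otimes>\<^bsub>A\<^esub> s \<in> S" if "r \<in> M" "s \<in> M" for r s
  proof -
    have "commutator (r \<otimes>\<^bsub>A\<^esub> s) c \<in> N (Suc n)" if c: "c \<in> carrier A" for c
    proof -
      have "r \<otimes>\<^bsub>A\<^esub> commutator s c \<in> N (1 + n)" "commutator r c \<otimes>\<^bsub>A\<^esub> s \<in> N (n + 1)"
        using \<open>r \<in> M\<close> \<open>s \<in> M\<close> c by (intro N_mult IH; simp add: M_N N_closed)+
      then show ?thesis using \<open>r \<in> M\<close> \<open>s \<in> M\<close> c by (simp add: commutator_rules(3) M_closed N_add)
    qed
    then show ?thesis using that by (simp add: S_def M_closed)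
  qed
  obtain c d where cd: "c \<in> carrier A" "d \<in> carrier A"
    and rel: "p \<otimes>\<^bsub>A\<^esub> c \<oplus>\<^bsub>A\<^esub> q \<otimes>\<^bsub>A\<^esub> d = \<zero>\<^bsub>A\<^esub>" and unit: "\<alpha> \<otimes>\<^bsub>A\<^esub> c \<oplus>\<^bsub>A\<^esub> \<beta> \<otimes>\<^bsub>A\<^esub> d = \<one>\<^bsub>A\<^esub>"
    by (rule syzygy_z)
  note pq_M
  \<comment> \<open>The second row \<open>(\<alpha>, \<beta>)\<close> takes \<open>(c, d)\<close> to \<open>1\<close>, so one augmentation survives; it decides
    which of \<open>p\<close> and \<open>q\<close> spans.\<close>
  have "aug c \<noteq> \<zero> \<or> aug d \<noteq> \<zero>"
  proof (rule ccontr)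
    assume "\<not> ?thesis"
    then have "aug (\<alpha> \<otimes>\<^bsub>A\<^esub> c \<oplus>\<^bsub>A\<^esub> \<beta> \<otimes>\<^bsub>A\<^esub> d) = \<zero>" using cd by simp
    then show False by (simp add: unit)
  qed
  then have "\<exists>t\<in>carrier A. \<forall>r\<in>carrier A. \<exists>k\<in>carrier K. \<exists>s\<in>S. r = k \<odot>\<^bsub>A\<^esub> t \<oplus>\<^bsub>A\<^esub> s"
  proof
    assume c0: "aug c \<noteq> \<zero>"
    have gen: "\<exists>u\<in>carrier A. \<exists>v\<in>carrier A. r = q \<otimes>\<^bsub>A\<^esub> u \<oplus>\<^bsub>A\<^esub> p \<otimes>\<^bsub>A\<^esub> v" if "r \<in> M" for r
      using syzygy_M[OF that] A.V.M.a_comm A.A.m_closed coeffs_closed by metis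
    have "\<exists>k\<in>carrier K. \<exists>s\<in>S. r = k \<odot>\<^bsub>A\<^esub> q \<oplus>\<^bsub>A\<^esub> s" if "r \<in> carrier A" for r
      by (rule span_line[where w = p and c = d and d = c]; fact)
    then show ?thesis using coeffs_closed(2) by blast
  next
    have rel': "q \<otimes>\<^bsub>A\<^esub> d \<oplus>\<^bsub>A\<^esub> p \<otimes>\<^bsub>A\<^esub> c = \<zero>\<^bsub>A\<^esub>" using rel cd by (simp add: A.V.M.a_comm)
    assume d0: "aug d \<noteq> \<zero>"
    have gen: "\<exists>u\<in>carrier A. \<exists>v\<in>carrier A. r = p \<otimes>\<^bsub>A\<^esub> u \<oplus>\<^bsub>A\<^esub> q \<otimes>\<^bsub>A\<^esub> v" if "r \<in> M" for r
      using syzygy_M[OF that] by metis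
    have "\<exists>k\<in>carrier K. \<exists>s\<in>S. r = k \<odot>\<^bsub>A\<^esub> p \<oplus>\<^bsub>A\<^esub> s" if "r \<in> carrier A" for r
      by (rule span_line[where w = q and c = c and d = d]; fact)
    then show ?thesis using coeffs_closed(1) by blast
  qed
  then obtain t where t: "t \<in> carrier A"
    and decomp: "\<And>r. r \<in> carrier A \<Longrightarrow> \<exists>k\<in>carrier K. \<exists>s\<in>S. r = k \<odot>\<^bsub>A\<^esub> t \<oplus>\<^bsub>A\<^esub> s" by blast
  obtain k s l s' where ks: "k \<in> carrier K" "s \<in> S" "l \<in> carrier K" "s' \<in> S"
    "a = k \<odot>\<^bsub>A\<^esub> t \<oplus>\<^bsub>A\<^esub> s" "b = l \<odot>\<^bsub>A\<^esub> t \<oplus>\<^bsub>A\<^esub> s'"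
    using decomp[OF ab(1)] decomp[OF ab(2)] by blast
  have tb: "commutator t b = (\<ominus> \<one>) \<odot>\<^bsub>A\<^esub> commutator s' t"
  proof -
    have "commutator t b = (\<ominus> \<one>) \<odot>\<^bsub>A\<^esub> commutator b t" using t ab by (simp add: commutator_rules(4)[of t b])
    also have "commutator b t = commutator s' t"
      using t ks(3,4) S_closed by (simp add: ks(6) commutator_rules(1,2,5,6))
    finally show ?thesis .
  qed
  have "commutator a b = k \<odot>\<^bsub>A\<^esub> commutator t b \<oplus>\<^bsub>A\<^esub> commutator s b"
    using t ab ks(1,2) S_closed by (simp add: ks(5) commutator_rules(1,2,6))
  moreover have "k \<odot>\<^bsub>A\<^esub> commutator t b \<in> N (Suc n)"
    unfolding tb using ks t by (intro N_smult) (auto simp: S_def)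
  moreover have "commutator s b \<in> N (Suc n)" using ks ab by (simp add: S_def)
  ultimately show ?thesis by (simp add: N_add)
qed

lemma commutative:
  assumes ab: "a \<in> carrier A" "b \<in> carrier A"
  shows "a \<otimes>\<^bsub>A\<^esub> b = b \<otimes>\<^bsub>A\<^esub> a"
proof -
  have "commutator a b \<in> N n" if "a \<in> carrier A" "b \<in> carrier A" for a b n
    using that
  proof (induction n arbitrary: a b)
    case 0
    then show ?case by (simp add: N_def order_ge_def \<iota>D(1) commutator_rules(6))
  next
    case (Suc n)
    then show ?case by (intro commutator_order_step)
  qed
  then have "commutator a b = \<zero>\<^bsub>A\<^esub>" using ab by (intro N_all) auto
  then have "commutator a b \<oplus>\<^bsub>A\<^esub> b \<otimes>\<^bsub>A\<^esub> a = b \<otimes>\<^bsub>A\<^esub> a" using ab by simp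
  then show ?thesis
    using ab by (simp add: commutator_def a_minus_def A.V.M.a_assoc A.V.M.l_neg)
qed

section \<open>A generator of the augmentation ideal\<close>

text \<open>Once \<open>A\<close> is commutative, the surjection of \<open>A\<^sup>2\<close> onto \<open>M \<oplus> A\<close> suggests to compare
  determinants, and \<open>M\<close> is generated by the determinant of the matrix with rows \<open>(p, q)\<close> and
  \<open>(\<alpha>, \<beta>)\<close>. By Cramer's rule, if \<open>(u, v)\<close> maps to \<open>(r, 0)\<close> and \<open>(c, d)\<close> maps to \<open>(0, 1)\<close>, the
  product of this determinant with \<open>u d - v c\<close> is \<open>r\<close>.\<close>

lemma M_principal: "\<exists>s\<in>M. \<forall>r\<in>M. \<exists>w\<in>carrier A. r = s \<otimes>\<^bsub>A\<^esub> w"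
proof -
  interpret A': cring A
    by (intro cring.intro A.A.ring_axioms comm_monoid.intro A.A.monoid_axioms
        comm_monoid_axioms.intro commutative)
  note [simp] = M_closed
  obtain c d where cd: "c \<in> carrier A" "d \<in> carrier A"
    and rel: "p \<otimes>\<^bsub>A\<^esub> c \<oplus>\<^bsub>A\<^esub> q \<otimes>\<^bsub>A\<^esub> d = \<zero>\<^bsub>A\<^esub>" and unit: "\<alpha> \<otimes>\<^bsub>A\<^esub> c \<oplus>\<^bsub>A\<^esub> \<beta> \<otimes>\<^bsub>A\<^esub> d = \<one>\<^bsub>A\<^esub>"
    by (rule syzygy_z)
  define s where "s = p \<otimes>\<^bsub>A\<^esub> \<beta> \<ominus>\<^bsub>A\<^esub> q \<otimes>\<^bsub>A\<^esub> \<alpha>"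
  have minus: "\<ominus>\<^bsub>A\<^esub> r = (\<ominus> \<one>) \<odot>\<^bsub>A\<^esub> r" if "r \<in> carrier A" for r
    using that by (simp add: A.smult_l_minus)
  have "s = p \<otimes>\<^bsub>A\<^esub> \<beta> \<oplus>\<^bsub>A\<^esub> (\<ominus> \<one>) \<odot>\<^bsub>A\<^esub> (q \<otimes>\<^bsub>A\<^esub> \<alpha>)"
    by (simp add: s_def a_minus_def minus)
  then have "s \<in> M"
    using pq_M unfolding M_def by simp
  moreover have "\<exists>w\<in>carrier A. r = s \<otimes>\<^bsub>A\<^esub> w" if r: "r \<in> M" for r
  proof -
    obtain u v where uv: "u \<in> carrier A" "v \<in> carrier A"
      and re: "r = p \<otimes>\<^bsub>A\<^esub> u \<oplus>\<^bsub>A\<^esub> q \<otimes>\<^bsub>A\<^esub> v" and rel': "\<alpha> \<otimes>\<^bsub>A\<^esub> u \<oplus>\<^bsub>A\<^esub> \<beta> \<otimes>\<^bsub>A\<^esub> v = \<zero>\<^bsub>A\<^esub>"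
      using syzygy_M[OF r] .
    have bv: "\<ominus>\<^bsub>A\<^esub> (\<beta> \<otimes>\<^bsub>A\<^esub> v) = \<alpha> \<otimes>\<^bsub>A\<^esub> u"
      using A.V.M.minus_equality[OF rel'] uv by simp
    have au: "\<ominus>\<^bsub>A\<^esub> (\<alpha> \<otimes>\<^bsub>A\<^esub> u) = \<beta> \<otimes>\<^bsub>A\<^esub> v"
      using uv by (simp add: bv[symmetric])
    have "s \<otimes>\<^bsub>A\<^esub> (u \<otimes>\<^bsub>A\<^esub> d \<ominus>\<^bsub>A\<^esub> v \<otimes>\<^bsub>A\<^esub> c)
      = (p \<otimes>\<^bsub>A\<^esub> u \<otimes>\<^bsub>A\<^esub> (\<beta> \<otimes>\<^bsub>A\<^esub> d) \<oplus>\<^bsub>A\<^esub> p \<otimes>\<^bsub>A\<^esub> c \<otimes>\<^bsub>A\<^esub> (\<ominus>\<^bsub>A\<^esub> (\<beta> \<otimes>\<^bsub>A\<^esub> v)))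
        \<oplus>\<^bsub>A\<^esub> (q \<otimes>\<^bsub>A\<^esub> d \<otimes>\<^bsub>A\<^esub> (\<ominus>\<^bsub>A\<^esub> (\<alpha> \<otimes>\<^bsub>A\<^esub> u)) \<oplus>\<^bsub>A\<^esub> q \<otimes>\<^bsub>A\<^esub> v \<otimes>\<^bsub>A\<^esub> (\<alpha> \<otimes>\<^bsub>A\<^esub> c))"
      using uv cd by (simp add: s_def A.A.ring_simprules A'.m_ac)
    also have "\<dots> = p \<otimes>\<^bsub>A\<^esub> u \<otimes>\<^bsub>A\<^esub> (\<alpha> \<otimes>\<^bsub>A\<^esub> c \<oplus>\<^bsub>A\<^esub> \<beta> \<otimes>\<^bsub>A\<^esub> d) \<oplus>\<^bsub>A\<^esub> q \<otimes>\<^bsub>A\<^esub> v \<otimes>\<^bsub>A\<^esub> (\<alpha> \<otimes>\<^bsub>A\<^esub> c \<oplus>\<^bsub>A\<^esub> \<beta> \<otimes>\<^bsub>A\<^esub> d)"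
      unfolding bv au using uv cd by (simp add: A.A.ring_simprules A'.m_ac)
    also have "\<dots> = r" unfolding unit re using uv by simp
    finally have "r = s \<otimes>\<^bsub>A\<^esub> (u \<otimes>\<^bsub>A\<^esub> d \<ominus>\<^bsub>A\<^esub> v \<otimes>\<^bsub>A\<^esub> c)" by (rule sym)
    moreover have "u \<otimes>\<^bsub>A\<^esub> d \<ominus>\<^bsub>A\<^esub> v \<otimes>\<^bsub>A\<^esub> c \<in> carrier A" using uv cd by simp
    ultimately show ?thesis by blast
  qed
  ultimately show ?thesis by blast
qed

section \<open>Degrees and polynomials in the generator\<close>

text \<open>Elements of \<open>M\<close> have no constant term, so a nonzero one has positive degree in \<open>G\<close>, and
  multiplication by it raises degrees.\<close>

lemma degree_drop:
  assumes s: "s \<in> M" and w: "w \<in> carrier A" and nz: "s \<noteq> \<zero>\<^bsub>A\<^esub>" and v: "\<iota> w v \<noteq> \<zero>"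
  obtains u where "length v < length u" "\<iota> (s \<otimes>\<^bsub>A\<^esub> w) u \<noteq> \<zero>"
proof -
  have sc: "s \<in> carrier A" "\<iota> s \<in> carrier G" using s \<iota>D(1) by (simp_all add: M_closed)
  have "\<iota> s \<noteq> \<zero>\<^bsub>G\<^esub>" using nz sc by (simp add: \<iota>_zero_iff)
  then obtain u0 where "\<iota> s u0 \<noteq> \<zero>" by (auto simp: ops)
  with sc(2) obtain u where u: "\<iota> s u \<noteq> \<zero>" "\<And>t. length u < length t \<Longrightarrow> \<iota> s t = \<zero>"
    by (rule longest_word) blast
  have "u \<noteq> []" using s u(1) by (auto simp: M_def aug_def)
  obtain v' where v': "\<iota> w v' \<noteq> \<zero>" "length v \<le> length v'" "\<And>t. length v' < length t \<Longrightarrow> \<iota> w t = \<zero>"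
    using \<iota>D(1)[OF w] v by (rule longest_word) blast
  have "\<iota> (s \<otimes>\<^bsub>A\<^esub> w) (u @ v') = \<iota> s u \<otimes> \<iota> w v'"
    using mult_apply_top[OF sc(2) \<iota>D(1)[OF w] u(2) v'(3)] sc(1) w by (simp add: \<iota>D(2))
  also have "\<dots> \<noteq> \<zero>"
    using u(1) v'(1) closed[OF sc(2)] closed[OF \<iota>D(1)[OF w]] by (simp add: K.integral_iff)
  finally show thesis using that[of "u @ v'"] v'(2) \<open>u \<noteq> []\<close> by (cases u) auto
qed

lemma mult_eq_zero:
  assumes s: "s \<in> M" and w: "w \<in> carrier A" and nz: "s \<noteq> \<zero>\<^bsub>A\<^esub>" and "s \<otimes>\<^bsub>A\<^esub> w = \<zero>\<^bsub>A\<^esub>"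
  shows "w = \<zero>\<^bsub>A\<^esub>"
proof (rule ccontr)
  assume "w \<noteq> \<zero>\<^bsub>A\<^esub>"
  then have "\<iota> w \<noteq> \<zero>\<^bsub>G\<^esub>" using w by (simp add: \<iota>_zero_iff)
  then obtain v where "\<iota> w v \<noteq> \<zero>" by (auto simp: ops)
  then obtain u where "\<iota> (s \<otimes>\<^bsub>A\<^esub> w) u \<noteq> \<zero>" using degree_drop[OF s w nz] by blast
  then show False using assms(4) \<iota>_zero by (simp add: ops)
qed

text \<open>Let \<open>s\<close> generate \<open>M\<close>. Splitting off the constant term and dividing by \<open>s\<close> lowers the degree,
  so that Horner's scheme writes every element of \<open>A\<close> as a polynomial in \<open>s\<close>. The expression is
  unique because its constant term is the augmentation and \<open>s\<close> is not a zero divisor.\<close>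

theorem polynomial_algebra: "alg_isomorphic K (free_algebra K (UNIV :: unit set)) A"
proof -
  let ?P = "free_algebra K (UNIV :: unit set)" and ?X = "word K [()]"
  interpret P: free_alg K "UNIV :: unit set" ?P by unfold_locales simp
  obtain s where s: "s \<in> M" and gen: "\<And>r. r \<in> M \<Longrightarrow> \<exists>w\<in>carrier A. r = s \<otimes>\<^bsub>A\<^esub> w"
    using M_principal by blast
  have sc: "s \<in> carrier A" using s by (rule M_closed)
  have nz: "s \<noteq> \<zero>\<^bsub>A\<^esub>"
  proof
    assume "s = \<zero>\<^bsub>A\<^esub>"
    then have M0: "r = \<zero>\<^bsub>A\<^esub>" if "r \<in> M" for r using gen[OF that] by auto
    obtain r where r: "r \<in> carrier A" "\<And>a. a \<in> carrier K \<Longrightarrow> r \<noteq> a \<odot>\<^bsub>A\<^esub> \<one>\<^bsub>A\<^esub>" using nontrivial by blast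
    obtain r' where "r' \<in> M" and re: "r = aug r \<odot>\<^bsub>A\<^esub> \<one>\<^bsub>A\<^esub> \<oplus>\<^bsub>A\<^esub> r'"
      using aug_split[OF r(1)] .
    then have "r = aug r \<odot>\<^bsub>A\<^esub> \<one>\<^bsub>A\<^esub> \<oplus>\<^bsub>A\<^esub> \<zero>\<^bsub>A\<^esub>" using M0[of r'] by metis
    also have "\<dots> = aug r \<odot>\<^bsub>A\<^esub> \<one>\<^bsub>A\<^esub>" using r(1) by simp
    finally show False using r(2)[OF aug_closed[OF r(1)]] by simp
  qed
  obtain h where h: "h \<in> alg_hom K ?P A" and hX: "h ?X = s"
    using free_algebra_universal[OF A.assoc_algebra_axioms, of "UNIV :: unit set" "\<lambda>_. s"] sc by auto
  note H = alg_homD[OF h]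
  have Xc: "?X \<in> carrier ?P" by (simp add: P.word_closed)
  have h_horner: "h (a \<odot>\<^bsub>?P\<^esub> \<one>\<^bsub>?P\<^esub> \<oplus>\<^bsub>?P\<^esub> ?X \<otimes>\<^bsub>?P\<^esub> g) = a \<odot>\<^bsub>A\<^esub> \<one>\<^bsub>A\<^esub> \<oplus>\<^bsub>A\<^esub> s \<otimes>\<^bsub>A\<^esub> h g"
    if "a \<in> carrier K" "g \<in> carrier ?P" for a g
    using that Xc by (simp add: H hX)
  have ker: "f = \<zero>\<^bsub>?P\<^esub>"
    if "f \<in> carrier ?P" "h f = \<zero>\<^bsub>A\<^esub>" "\<And>w. n \<le> length w \<Longrightarrow> f w = \<zero>" for f n
    using that
  proof (induction n arbitrary: f)
    case 0
    then show ?case by (simp add: P.ops fun_eq_iff)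
  next
    case (Suc n)
    note f = Suc.prems(1)
    define g where "g = P.shift () f"
    have g: "g \<in> carrier ?P" using f by (simp add: g_def P.shift_closed)
    have fe: "f = f [] \<odot>\<^bsub>?P\<^esub> \<one>\<^bsub>?P\<^esub> \<oplus>\<^bsub>?P\<^esub> ?X \<otimes>\<^bsub>?P\<^esub> g"
      unfolding g_def P.shift_def by (rule free_algebra_decompose_unit[OF K.is_cring f])
    have a: "f [] \<in> carrier K" by (rule P.closed[OF f])
    have hf: "f [] \<odot>\<^bsub>A\<^esub> \<one>\<^bsub>A\<^esub> \<oplus>\<^bsub>A\<^esub> s \<otimes>\<^bsub>A\<^esub> h g = \<zero>\<^bsub>A\<^esub>"
      using h_horner[OF a g] Suc.prems(2) unfolding fe[symmetric] by simp
    then have "aug (f [] \<odot>\<^bsub>A\<^esub> \<one>\<^bsub>A\<^esub> \<oplus>\<^bsub>A\<^esub> s \<otimes>\<^bsub>A\<^esub> h g) = \<zero>" by simp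
    then have f0: "f [] = \<zero>" using s sc a g H(1) by (simp add: M_def)
    then have "s \<otimes>\<^bsub>A\<^esub> h g = \<zero>\<^bsub>A\<^esub>" using hf sc H(1)[OF g] by simp
    then have "h g = \<zero>\<^bsub>A\<^esub>" using mult_eq_zero[OF s H(1)[OF g] nz] by simp
    then have "g = \<zero>\<^bsub>?P\<^esub>"
      using g Suc.prems(3) by (intro Suc.IH) (auto simp: g_def P.shift_def)
    then have g0: "f (() # w) = \<zero>" for w by (auto simp: g_def P.shift_def P.ops fun_eq_iff)
    show ?case
    proof
      fix w show "f w = \<zero>\<^bsub>?P\<^esub> w" using f0 g0 by (cases w) (auto simp: P.ops)
    qed
  qed
  have inj: "f = g" if fg: "f \<in> carrier ?P" "g \<in> carrier ?P" "h f = h g" for f g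
  proof -
    let ?d = "f \<ominus>\<^bsub>?P\<^esub> g"
    have dc: "?d \<in> carrier ?P" using fg by simp
    have "h ?d = h g \<ominus>\<^bsub>A\<^esub> h g"
      using alg_hom_diff[OF P.assoc_algebra A.assoc_algebra_axioms h fg(1,2)] fg(3) by simp
    then have hd: "h ?d = \<zero>\<^bsub>A\<^esub>" using H(1)[OF fg(2)] by (simp add: a_minus_def A.V.M.r_neg)
    have "finite (length ` {w. ?d w \<noteq> \<zero>})" using P.support(1)[OF dc] by simp
    then obtain n where "\<And>w. ?d w \<noteq> \<zero> \<Longrightarrow> length w < n"
      by (auto simp: finite_nat_set_iff_bounded)
    then have "?d = \<zero>\<^bsub>?P\<^esub>" by (intro ker[OF dc hd, where n = n]) (meson leD)
    then have "?d \<oplus>\<^bsub>?P\<^esub> g = g" using fg by simp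
    then show ?thesis using fg by (simp add: a_minus_def P.FA.V.M.a_assoc P.FA.V.M.l_neg)
  qed
  have surj: "\<exists>f\<in>carrier ?P. h f = r"
    if "r \<in> carrier A" "\<And>w. n \<le> length w \<Longrightarrow> \<iota> r w = \<zero>" for r n
    using that
  proof (induction n arbitrary: r)
    case 0
    then have "r = \<zero>\<^bsub>A\<^esub>" using \<iota>_zero_iff[of r] by (simp add: ops fun_eq_iff)
    moreover have "h \<zero>\<^bsub>?P\<^esub> = \<zero>\<^bsub>A\<^esub>" using H(5)[of \<zero> ?X] Xc sc hX by simp
    ultimately show ?case by (intro bexI[of _ "\<zero>\<^bsub>?P\<^esub>"]) auto
  next
    case (Suc n)
    obtain r' where r': "r' \<in> M" "r = aug r \<odot>\<^bsub>A\<^esub> \<one>\<^bsub>A\<^esub> \<oplus>\<^bsub>A\<^esub> r'" using aug_split[OF Suc.prems(1)] .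
    obtain w where w: "w \<in> carrier A" "r' = s \<otimes>\<^bsub>A\<^esub> w" using gen[OF r'(1)] by blast
    have "\<iota> w v = \<zero>" if v: "n \<le> length v" for v
    proof (rule ccontr)
      assume "\<iota> w v \<noteq> \<zero>"
      then obtain u where u: "length v < length u" "\<iota> r' u \<noteq> \<zero>"
        using degree_drop[OF s w(1) nz] w(2) by blast
      have "\<iota> (aug r \<odot>\<^bsub>A\<^esub> \<one>\<^bsub>A\<^esub> \<oplus>\<^bsub>A\<^esub> r') = aug r \<odot>\<^bsub>G\<^esub> \<one>\<^bsub>G\<^esub> \<oplus>\<^bsub>G\<^esub> \<iota> r'"
        using M_closed[OF r'(1)] Suc.prems(1) by (simp add: \<iota>D)
      then have "\<iota> r = aug r \<odot>\<^bsub>G\<^esub> \<one>\<^bsub>G\<^esub> \<oplus>\<^bsub>G\<^esub> \<iota> r'"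
        unfolding r'(2)[symmetric] .
      then have "\<iota> r u = \<iota> r' u"
        using u(1) Suc.prems(1) closed[OF \<iota>D(1)[OF M_closed[OF r'(1)]]] by (auto simp: ops)
      then show False using u v Suc.prems(2)[of u] by simp
    qed
    then obtain g where g: "g \<in> carrier ?P" "h g = w" using Suc.IH[OF w(1)] by blast
    have "h (aug r \<odot>\<^bsub>?P\<^esub> \<one>\<^bsub>?P\<^esub> \<oplus>\<^bsub>?P\<^esub> ?X \<otimes>\<^bsub>?P\<^esub> g) = r"
      using h_horner[OF aug_closed[OF Suc.prems(1)] g(1)] r'(2)[symmetric]
      by (simp add: g(2) w(2)[symmetric])
    moreover have "aug r \<odot>\<^bsub>?P\<^esub> \<one>\<^bsub>?P\<^esub> \<oplus>\<^bsub>?P\<^esub> ?X \<otimes>\<^bsub>?P\<^esub> g \<in> carrier ?P"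
      using g(1) Xc Suc.prems(1) by simp
    ultimately show ?case by blast
  qed
  have "bij_betw h (carrier ?P) (carrier A)"
  proof (rule bij_betwI')
    show "h f = h g \<longleftrightarrow> f = g" if "f \<in> carrier ?P" "g \<in> carrier ?P" for f g using inj that by blast
    show "\<exists>f\<in>carrier ?P. r = h f" if r: "r \<in> carrier A" for r
    proof -
      have "finite (length ` {w. \<iota> r w \<noteq> \<zero>})" using support(1)[OF \<iota>D(1)[OF r]] by simp
      then obtain n where "\<And>w. \<iota> r w \<noteq> \<zero> \<Longrightarrow> length w < n"
        by (auto simp: finite_nat_set_iff_bounded)
      then have "\<And>w. n \<le> length w \<Longrightarrow> \<iota> r w = \<zero>" by (meson leD)
      from surj[OF r this] show ?thesis by blast
    qed
  qed (rule H(1))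
  then show ?thesis using h by (auto simp: alg_isomorphic_def)
qed

end

section \<open>From the free product to a free factor\<close>

lemma (in free_alg) const_coeff_hom:
  assumes C: "assoc_algebra K C"
  shows "(\<lambda>f. f [] \<odot>\<^bsub>C\<^esub> \<one>\<^bsub>C\<^esub>) \<in> alg_hom K F C"
proof -
  interpret C: assoc_algebra K C by fact
  show ?thesis
  proof (rule alg_homI)
    fix f g assume fg: "f \<in> carrier F" "g \<in> carrier F"
    note [simp] = closed[OF fg(1)] closed[OF fg(2)]
    show "(f \<otimes>\<^bsub>F\<^esub> g) [] \<odot>\<^bsub>C\<^esub> \<one>\<^bsub>C\<^esub> = (f [] \<odot>\<^bsub>C\<^esub> \<one>\<^bsub>C\<^esub>) \<otimes>\<^bsub>C\<^esub> (g [] \<odot>\<^bsub>C\<^esub> \<one>\<^bsub>C\<^esub>)"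
      using fg by (simp add: mult_apply_Nil C.smult_mult_left C.smult_assoc1)
    show "(f \<oplus>\<^bsub>F\<^esub> g) [] \<odot>\<^bsub>C\<^esub> \<one>\<^bsub>C\<^esub> = f [] \<odot>\<^bsub>C\<^esub> \<one>\<^bsub>C\<^esub> \<oplus>\<^bsub>C\<^esub> g [] \<odot>\<^bsub>C\<^esub> \<one>\<^bsub>C\<^esub>"
      by (simp add: ops(1) C.smult_l_distr)
  next
    fix a f assume "a \<in> carrier K" "f \<in> carrier F"
    then show "(a \<odot>\<^bsub>F\<^esub> f) [] \<odot>\<^bsub>C\<^esub> \<one>\<^bsub>C\<^esub> = a \<odot>\<^bsub>C\<^esub> (f [] \<odot>\<^bsub>C\<^esub> \<one>\<^bsub>C\<^esub>)"
      using closed[of f "[]"] by (simp add: ops(3) C.smult_assoc1)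
  qed (auto simp: closed ops(5))
qed

lemma triangular_diagonal_homs:
  "fst \<in> alg_hom K (triangular A) A" "(\<lambda>t. snd (snd t)) \<in> alg_hom K (triangular A) A"
  by (rule alg_homI; auto simp: triangular_simps)+

text \<open>The homomorphism from the free product to triangular matrices sends \<open>r\<close> to
  \<open>(\<epsilon> r, 0, r)\<close> and \<open>z\<close> to \<open>(\<epsilon> z, 1, \<epsilon> z)\<close>, where \<open>\<epsilon>\<close> is the constant term in
  \<open>K\<langle>x, y\<rangle>\<close>. Its entries are \<open>\<epsilon>\<close>, the derivation \<open>\<zeta>\<close> and the retraction \<open>\<pi>\<close>. Sending \<open>z\<close> to
  \<open>\<epsilon> z\<close> rather than to \<open>0\<close> is what makes \<open>\<pi>\<close> compatible with \<open>\<epsilon>\<close>, so that no change of the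
  variables \<open>x\<close>, \<open>y\<close> is required.\<close>

lemma free_factor_ex:
  fixes K :: "('k, 'l) ring_scheme" (structure) and R :: "('k, 'r, 'm) module_scheme" (structure)
  assumes K: "field K" and R: "assoc_algebra K R"
    and iso: "alg_isomorphic K (free_product K R (UP K)) (free_algebra K (UNIV :: bool set))"
  shows "\<exists>\<iota> \<pi> \<zeta> z. free_factor K R (free_algebra K UNIV) \<iota> \<pi> \<zeta> z"
proof -
  interpret K: field K by fact
  interpret R: assoc_algebra K R by fact
  have cK: "cring K" by (rule K.is_cring)
  define U where "U = UP K"
  interpret two_algebras K R U
    unfolding U_def by (intro two_algebras.intro R UP_assoc_algebra cK)
  define G where "G = free_algebra K (UNIV :: bool set)"
  interpret G: free_alg K "UNIV :: bool set" G by unfold_locales (simp add: G_def)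
  define L where "L = free_product K R U"
  have LA: "assoc_algebra K L" unfolding L_def by (rule free_product_assoc_algebra)
  obtain h where h: "h \<in> alg_hom K L G" and hb: "bij_betw h (carrier L) (carrier G)"
    using iso by (auto simp: alg_isomorphic_def L_def G_def U_def)
  define hi where "hi = inv_into (carrier L) h"
  have hi: "hi \<in> alg_hom K G L" unfolding hi_def by (rule alg_hom_inverse[OF LA h hb])
  have hi_h: "hi (h a) = a" if "a \<in> carrier L" for a
    unfolding hi_def by (rule inv_into_f_f[OF bij_betw_imp_inj_on[OF hb] that])
  have h_hi: "h (hi f) = f" if "f \<in> carrier G" for f
    unfolding hi_def by (rule f_inv_into_f) (use hb that in \<open>auto simp: bij_betw_def\<close>)
  define il where "il = free_product_inl K R U"
  define ir where "ir = free_product_inr K R U"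
  have il: "il \<in> alg_hom K R L" and ir: "ir \<in> alg_hom K U L"
    unfolding il_def ir_def L_def by (rule free_product_inl_hom free_product_inr_hom)+
  note unique = free_product_hom_unique[folded L_def il_def ir_def]
  define X where "X = UP_var K"
  have X: "X \<in> carrier U" unfolding X_def U_def by (rule UP_var_closed[OF cK])
  define \<iota> where "\<iota> = (\<lambda>r. h (il r))"
  have \<iota>: "\<iota> \<in> alg_hom K R G" unfolding \<iota>_def by (rule alg_hom_compose[OF il h])
  note \<iota>D = alg_homD[OF \<iota>] and hD = alg_homD[OF h] and hiD = alg_homD[OF hi]
    and ilD = alg_homD[OF il] and irD = alg_homD[OF ir]
  define y where "y = h (ir X)"
  have y: "y \<in> carrier G" unfolding y_def by (intro hD irD X)
  define e where "e = (\<lambda>f :: bool list \<Rightarrow> 'k. f [] \<odot>\<^bsub>R\<^esub> \<one>\<^bsub>R\<^esub>)"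
  have e: "e \<in> alg_hom K G R" unfolding e_def by (rule G.const_coeff_hom[OF R])
  note eD = alg_homD[OF e]
  let ?T = "triangular R"
  have T: "assoc_algebra K ?T" by (rule triangular_assoc_algebra[OF R])
  have \<phi>: "(\<lambda>r. (e (\<iota> r), \<zero>\<^bsub>R\<^esub>, r)) \<in> alg_hom K R ?T"
    by (rule alg_homI) (simp_all add: triangular_simps eD \<iota>D)
  obtain g where g: "g \<in> alg_hom K U ?T" "g X = (e y, \<one>\<^bsub>R\<^esub>, e y)"
    using UP_hom_ex[OF T, of "(e y, \<one>\<^bsub>R\<^esub>, e y)"] eD(1)[OF y]
    by (auto simp: triangular_simps U_def X_def)
  obtain H where H: "H \<in> alg_hom K L ?T"
    and H_il: "\<And>r. r \<in> carrier R \<Longrightarrow> H (il r) = (e (\<iota> r), \<zero>\<^bsub>R\<^esub>, r)"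
    and H_ir: "\<And>u. u \<in> carrier U \<Longrightarrow> H (ir u) = g u"
    using free_product_universal[OF T \<phi> g(1), folded L_def il_def ir_def] by blast
  note HD = alg_homD[OF H]
  have agree: "f a = f' a"
    if "f \<in> alg_hom K L R" "f' \<in> alg_hom K L R" "\<And>r. r \<in> carrier R \<Longrightarrow> f (il r) = f' (il r)"
      "f (ir X) = f' (ir X)" "a \<in> carrier L" for f f' a
  proof (rule unique[OF R that(1,2,3) _ that(5)])
    show "f (ir u) = f' (ir u)" if u: "u \<in> carrier U" for u
      using UP_hom_unique[OF R alg_hom_compose[OF ir[unfolded U_def] \<open>f \<in> _\<close>]
          alg_hom_compose[OF ir[unfolded U_def] \<open>f' \<in> _\<close>]] \<open>f (ir X) = f' (ir X)\<close> u
      unfolding U_def X_def by blast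
  qed
  \<comment> \<open>The diagonal entries of the matrices are identified by comparing algebra homomorphisms on
    \<open>R\<close> and on the variable.\<close>
  have H_fst: "fst (H a) = e (h a)" if "a \<in> carrier L" for a
    by (rule agree[OF alg_hom_compose[OF H triangular_diagonal_homs(1)] alg_hom_compose[OF h e] _ _ that])
      (simp_all add: H_il H_ir X g(2) \<iota>_def y_def)
  have last_hom: "(\<lambda>a. snd (snd (H a))) \<in> alg_hom K L R"
    by (rule alg_hom_compose[OF H triangular_diagonal_homs(2)])
  have e_smult_one: "e (\<iota> (c \<odot>\<^bsub>R\<^esub> \<one>\<^bsub>R\<^esub>)) = c \<odot>\<^bsub>R\<^esub> \<one>\<^bsub>R\<^esub>" if "c \<in> carrier K" for c
    using that eD(4) by (simp add: \<iota>D(4,5) eD(5))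
  have H_snd_aug: "e (\<iota> (snd (snd (H a)))) = e (h a)" if "a \<in> carrier L" for a
    by (rule agree[OF alg_hom_compose[OF alg_hom_compose[OF last_hom \<iota>] e] alg_hom_compose[OF h e] _ _ that])
      (simp_all add: H_il H_ir X g(2) \<iota>_def[symmetric] y_def[symmetric] e_smult_one G.closed[OF y]
        e_def[THEN fun_cong, of y] \<iota>_def[THEN fun_cong, symmetric])
  \<comment> \<open>Scalars of \<open>R\<close> can be compared after inclusion into \<open>K\<langle>x, y\<rangle>\<close>; in particular \<open>R\<close> is not
    the zero algebra.\<close>
  have e_eq: "f [] = f' []" if "f \<in> carrier G" "f' \<in> carrier G" "e f = e f'" for f f'
  proof -
    have c: "f [] \<in> carrier K" "f' [] \<in> carrier K" using that G.closed by blast+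
    have "\<iota> (f [] \<odot>\<^bsub>R\<^esub> \<one>\<^bsub>R\<^esub>) [] = \<iota> (f' [] \<odot>\<^bsub>R\<^esub> \<one>\<^bsub>R\<^esub>) []" using that(3) by (simp add: e_def)
    then show ?thesis using c by (simp add: \<iota>D(4,5) G.one_apply)
  qed
  define \<pi> where "\<pi> = (\<lambda>f. snd (snd (H (hi f))))"
  have \<pi>: "\<pi> \<in> alg_hom K G R" unfolding \<pi>_def by (rule alg_hom_compose[OF hi last_hom])
  note \<pi>D = alg_homD[OF \<pi>]
  define \<zeta> where "\<zeta> = (\<lambda>f. fst (snd (H (hi f))))"
  have Hhi: "H (hi f) = (e f, \<zeta> f, \<pi> f)" if "f \<in> carrier G" for f
    using H_fst[OF hiD(1)[OF that]] by (simp add: \<zeta>_def \<pi>_def h_hi that prod_eq_iff)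
  have \<zeta>_closed: "\<zeta> f \<in> carrier R" if "f \<in> carrier G" for f
    using HD(1)[OF hiD(1)[OF that]] by (simp add: Hhi that triangular_simps)
  have tri: "(e (f \<otimes>\<^bsub>G\<^esub> f'), \<zeta> (f \<otimes>\<^bsub>G\<^esub> f'), \<pi> (f \<otimes>\<^bsub>G\<^esub> f')) = (e f, \<zeta> f, \<pi> f) \<otimes>\<^bsub>?T\<^esub> (e f', \<zeta> f', \<pi> f')"
    if "f \<in> carrier G" "f' \<in> carrier G" for f f'
    using that by (simp add: Hhi[symmetric] hiD HD G.mult_closed)
  have tri_add: "(e (f \<oplus>\<^bsub>G\<^esub> f'), \<zeta> (f \<oplus>\<^bsub>G\<^esub> f'), \<pi> (f \<oplus>\<^bsub>G\<^esub> f')) = (e f, \<zeta> f, \<pi> f) \<oplus>\<^bsub>?T\<^esub> (e f', \<zeta> f', \<pi> f')"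
    if "f \<in> carrier G" "f' \<in> carrier G" for f f'
    using that by (simp add: Hhi[symmetric] hiD HD G.add_closed)
  have il_il: "H (hi (\<iota> r)) = (e (\<iota> r), \<zero>\<^bsub>R\<^esub>, r)" if "r \<in> carrier R" for r
    using that by (simp add: \<iota>_def hi_h ilD(1) H_il)
  have yH: "H (hi y) = (e y, \<one>\<^bsub>R\<^esub>, e y)" using X by (simp add: y_def hi_h irD(1) H_ir) (simp add: g y_def)
  \<comment> \<open>The complementary variable is translated to have constant term zero.\<close>
  define c where "c = \<ominus> y []"
  have c: "c \<in> carrier K" unfolding c_def using G.closed[OF y] by simp
  define z where "z = \<iota> (c \<odot>\<^bsub>R\<^esub> \<one>\<^bsub>R\<^esub>) \<oplus>\<^bsub>G\<^esub> y"
  have c1: "c \<odot>\<^bsub>R\<^esub> \<one>\<^bsub>R\<^esub> \<in> carrier R" "\<iota> (c \<odot>\<^bsub>R\<^esub> \<one>\<^bsub>R\<^esub>) \<in> carrier G" using c by (simp_all add: \<iota>D(1))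
  have z: "z \<in> carrier G" unfolding z_def using c1(2) y by (rule G.add_closed)
  have c1_nil: "\<iota> (c \<odot>\<^bsub>R\<^esub> \<one>\<^bsub>R\<^esub>) [] = c"
    using c by (simp add: \<iota>D(4,5) G.one_apply)
  have z_nil: "z [] = \<zero>"
    using G.closed[OF y] c1_nil by (simp add: z_def G.ops(1) c_def K.l_neg)
  have "e z = \<zero>\<^bsub>R\<^esub>" by (simp add: e_def z_nil)
  have "\<pi> z = c \<odot>\<^bsub>R\<^esub> \<one>\<^bsub>R\<^esub> \<oplus>\<^bsub>R\<^esub> e y"
    using tri_add[OF c1(2) y] il_il[OF c1(1)] yH by (simp add: z_def Hhi c1 y triangular_simps)
  also have "\<dots> = \<zero>\<^bsub>R\<^esub>"
    using G.closed[OF y] c by (simp add: e_def R.smult_l_distr[symmetric] c_def K.l_neg)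
  finally have \<pi>z: "\<pi> z = \<zero>\<^bsub>R\<^esub>" .
  have \<zeta>z: "\<zeta> z = \<one>\<^bsub>R\<^esub>"
    using tri_add[OF c1(2) y] il_il[OF c1(1)] yH by (simp add: z_def Hhi c1 y triangular_simps)
  have nontrivial: "\<exists>r\<in>carrier R. \<forall>a\<in>carrier K. r \<noteq> a \<odot>\<^bsub>R\<^esub> \<one>\<^bsub>R\<^esub>"
  proof (rule ccontr)
    assume "\<not> ?thesis"
    then have "carrier R = (\<lambda>a. a \<odot>\<^bsub>R\<^esub> \<one>\<^bsub>R\<^esub>) ` carrier K" by auto
    moreover have "u \<otimes>\<^bsub>U\<^esub> v = v \<otimes>\<^bsub>U\<^esub> u" if "u \<in> carrier U" "v \<in> carrier U" for u v
    proof -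
      interpret UP_cring K "UP K" by (simp_all add: UP_cring_def cK)
      show ?thesis using that unfolding U_def by (rule UP_m_comm)
    qed
    ultimately have comm: "a \<otimes>\<^bsub>L\<^esub> b = b \<otimes>\<^bsub>L\<^esub> a" if "a \<in> carrier L" "b \<in> carrier L" for a b
      using that unfolding L_def by (rule free_product_trivial_comm)
    have comm_G: "f \<otimes>\<^bsub>G\<^esub> f' = f' \<otimes>\<^bsub>G\<^esub> f" if "f \<in> carrier G" "f' \<in> carrier G" for f f'
      using hD(2)[OF hiD(1) hiD(1)] comm[OF hiD(1) hiD(1)] h_hi that by metis
    have "word K [True, False] = word K [False, True]"
      using comm_G[of "word K [True]" "word K [False]"] by (simp add: G.word_closed G.word_mult)
    from fun_cong[OF this, of "[True, False]"] show False by (simp add: word_def)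
  qed
  have "free_factor K R G \<iota> \<pi> \<zeta> z"
  proof (intro free_factor.intro free_factor_axioms.intro K R)
    show "G = free_algebra K UNIV" by (rule G_def)
    show "\<pi> (\<iota> r) = r" "\<zeta> (\<iota> r) = \<zero>\<^bsub>R\<^esub>" if "r \<in> carrier R" for r
      using il_il[OF that] \<iota>D(1)[OF that] by (simp_all add: Hhi)
    show "\<iota> (\<pi> f) [] = f []" if f: "f \<in> carrier G" for f
      using H_snd_aug[OF hiD(1)[OF f]] f
      by (intro e_eq) (simp_all add: \<pi>_def[symmetric] h_hi \<iota>D(1) \<pi>D(1) Hhi)
    show "\<zeta> (f \<oplus>\<^bsub>G\<^esub> f') = \<zeta> f \<oplus>\<^bsub>R\<^esub> \<zeta> f'" if "f \<in> carrier G" "f' \<in> carrier G" for f f'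
      using tri_add[OF that] by (simp add: triangular_simps)
    show "\<zeta> (f \<otimes>\<^bsub>G\<^esub> f') = f [] \<odot>\<^bsub>R\<^esub> \<zeta> f' \<oplus>\<^bsub>R\<^esub> \<zeta> f \<otimes>\<^bsub>R\<^esub> \<pi> f'"
      if "f \<in> carrier G" "f' \<in> carrier G" for f f'
      using tri[OF that] that
      by (simp add: triangular_simps e_def R.smult_mult_left \<zeta>_closed G.closed)
  qed (fact \<iota> \<pi> \<zeta>_closed z z_nil \<pi>z \<zeta>z nontrivial)+
  then show ?thesis unfolding G_def by blast
qed

theorem theorem1p3:
  fixes K :: "('k, 'l) ring_scheme"
    and R :: "('k, 'r, 'm) module_scheme"
  assumes "field K"
    and "assoc_algebra K R"
    and "alg_isomorphic K (free_product K R (UP K)) (free_algebra K (UNIV :: bool set))"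
  shows "alg_isomorphic K R (UP K)"
proof -
  have K: "cring K" using assms(1) by (simp add: field.is_ring fieldE(1))
  obtain \<iota> \<pi> \<zeta> z where "free_factor K R (free_algebra K UNIV) \<iota> \<pi> \<zeta> z"
    using free_factor_ex[OF assms] by blast
  then have "alg_isomorphic K (free_algebra K (UNIV :: unit set)) R"
    by (rule free_factor.polynomial_algebra)
  moreover have "alg_isomorphic K (UP K) (free_algebra K (UNIV :: unit set))"
    using UP_to_free_iso[OF K] unfolding alg_isomorphic_def by blast
  ultimately have "alg_isomorphic K (UP K) R" by (rule alg_isomorphic_trans[rotated])
  then show ?thesis by (rule alg_isomorphic_sym[OF UP_assoc_algebra[OF K]])
qed

end
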